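(* Let $H$ be a complex Hilbert space, $Z=\mathcal{L}(H)$, and let $\mathcal{A}$ be the set of all non-zero normal algebraic elements of finite rank in $Z$. Then $$\mathcal{A}=\bigcup_{n,\Lambda,R}M(n,\Lambda,R),$$ where $n$ ranges over the positive integers, $\Lambda=(\lambda_1,\dots,\lambda_n)$ over the $n$-tuples of pairwise distinct non-zero complex numbers and $R=(r_1,\dots,r_n)$ over the $n$-tuples of positive integers. This union is disjoint, when $(\Lambda,R)$ is taken up to simultaneous permutation of the indices $1,\dots,n$. Moreover, each $M(n,\Lambda,R)$ is an $\mathrm{Aut}^{\circ}(Z)$-invariant connected subset of $Z$ on which the group $\mathrm{Aut}^{\circ}(Z)$ acts transitively.
   Context: $\mathcal{L}(H)$ is the $C^*$-algebra of bounded linear operators on $H$ with the norm topology. An element $a\in Z$ is algebraic if $p(a)=0$ for some non-zero polynomial $p\in\mathbb{C}[X]$; it has finite rank if $\dim a(H)<\infty$. "Projection" means self-adjoint idempotent, and the rank of a projection is the dimension of its range. For a positive integer $n$, an $n$-tuple $\Lambda=(\lambda_1,\dots,\lambda_n)$ of pairwise distinct non-zero complex numbers and an $n$-tuple $R=(r_1,\dots,r_n)$ of positive integers, $$M(n,\Lambda,R)=\Big\{\sum_{k=1}^n\lambda_ke_k:\ e_1,\dots,e_n \text{ projections in } Z,\ e_je_k=0 \text{ for } j\ne k,\ \mathrm{rank}(e_k)=r_k\Big\}.$$ $\mathrm{Aut}(Z)$ is the group of $C^*$-algebra automorphisms of $Z$ and $\mathrm{Aut}^{\circ}(Z)$ is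 its identity component; its elements are the maps $z\mapsto UzU^*$ with $U$ a unitary operator on $H$. *)

theory Defs
  imports
    "HOL-Analysis.Analysis"
    "HOL-Combinatorics.Permutations"
    "HOL-Computational_Algebra.Polynomial"
begin

section \<open>Complex Hilbert spaces\<close>

class complex_vector = real_vector +
  fixes scaleC :: "complex \<Rightarrow> 'a \<Rightarrow> 'a"  (infixr \<open>*\<^sub>C\<close> 75)
  assumes scaleC_add_right: "c *\<^sub>C (x + y) = c *\<^sub>C x + c *\<^sub>C y"
    and scaleC_add_left: "(c + d) *\<^sub>C x = c *\<^sub>C x + d *\<^sub>C x"
    and scaleC_scaleC: "c *\<^sub>C (d *\<^sub>C x) = (c * d) *\<^sub>C x"
    and scaleC_one: "1 *\<^sub>C x = x"
    and scaleR_scaleC: "r *\<^sub>R x = complex_of_real r *\<^sub>C x"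

text \<open>This provides the complex span and the complex dimension.\<close>

global_interpretation complex_vector: vector_space "scaleC :: complex \<Rightarrow> 'a::complex_vector \<Rightarrow> 'a"
  defines cspan = complex_vector.span
    and cdim = complex_vector.dim
  by unfold_locales (simp_all add: scaleC_add_right scaleC_add_left scaleC_scaleC scaleC_one)

text \<open>The inner product is linear in the first argument. The trivial space is not excluded.\<close>

class complex_hilbert = complex_vector + banach +
  fixes cinner :: "'a \<Rightarrow> 'a \<Rightarrow> complex"
  assumes cinner_commute: "cinner x y = cnj (cinner y x)"
    and cinner_add_left: "cinner (x + y) z = cinner x z + cinner y z"
    and cinner_scaleC_left: "cinner (c *\<^sub>C x) y = c * cinner x y"
    and cinner_ge_zero: "0 \<le> Re (cinner x x)"
    and cinner_eq_zero_iff: "cinner x x = 0 \<longleftrightarrow> x = 0"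
    and norm_eq_sqrt_cinner: "norm x = sqrt (Re (cinner x x))"


section \<open>The algebra of bounded linear operators\<close>

text \<open>The elements are the bounded real-linear maps that are complex-linear. The operator norm of
  such a map does not depend on the scalar field, so the norm is inherited from the type of
  bounded real-linear maps.\<close>

typedef (overloaded) 'a bop =
  "{f :: 'a::complex_hilbert \<Rightarrow>\<^sub>L 'a. \<forall>c x. blinfun_apply f (c *\<^sub>C x) = c *\<^sub>C blinfun_apply f x}"
  morphisms blinfun_of_bop Bop
  by (rule exI[of _ 0]) (simp add: complex_vector.scale_zero_right)

setup_lifting type_definition_bop

lift_definition bop_apply :: "'a::complex_hilbert bop \<Rightarrow> 'a \<Rightarrow> 'a" is blinfun_apply .

lemma scaleC_scaleR_commute: "c *\<^sub>C (r *\<^sub>R x) = r *\<^sub>R (c *\<^sub>C (x :: 'a::complex_vector))"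
  by (simp add: scaleR_scaleC scaleC_scaleC mult.commute)

lemma bounded_linear_scaleC: "bounded_linear (\<lambda>x :: 'a::complex_hilbert. c *\<^sub>C x)"
proof (rule bounded_linear_intro[where K = "cmod c"])
  fix x :: 'a
  have "cinner (c *\<^sub>C x) (c *\<^sub>C x) = c * cnj c * cinner x x"
    by (metis cinner_commute cinner_scaleC_left complex_cnj_mult mult.assoc)
  then have "Re (cinner (c *\<^sub>C x) (c *\<^sub>C x)) = (cmod c)\<^sup>2 * Re (cinner x x)"
    by (simp add: complex_norm_square [symmetric] del: of_real_power)
  then show "norm (c *\<^sub>C x) \<le> norm x * cmod c"
    by (simp add: norm_eq_sqrt_cinner real_sqrt_mult)
qed (simp_all add: scaleC_add_right scaleC_scaleR_commute)

lemma bop_eqI: "(\<And>x. bop_apply a x = bop_apply b x) \<Longrightarrow> a = b"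
  by transfer (rule blinfun_eqI)

instantiation bop :: (complex_hilbert) complex_vector
begin

lift_definition zero_bop :: "'a bop" is 0
  by (simp add: complex_vector.scale_zero_right)
lift_definition plus_bop :: "'a bop \<Rightarrow> 'a bop \<Rightarrow> 'a bop" is plus
  by (simp add: blinfun.add_left scaleC_add_right)
lift_definition minus_bop :: "'a bop \<Rightarrow> 'a bop \<Rightarrow> 'a bop" is minus
  by (simp add: blinfun.diff_left complex_vector.scale_right_diff_distrib)
lift_definition uminus_bop :: "'a bop \<Rightarrow> 'a bop" is uminus
  by (simp add: blinfun.minus_left complex_vector.scale_minus_right)
lift_definition scaleR_bop :: "real \<Rightarrow> 'a bop \<Rightarrow> 'a bop" is scaleR
  by (simp add: blinfun.scaleR_left scaleC_scaleR_commute)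
lift_definition scaleC_bop :: "complex \<Rightarrow> 'a bop \<Rightarrow> 'a bop"
  is "\<lambda>c f. Blinfun (\<lambda>x. c *\<^sub>C blinfun_apply f x)"
  by (simp add: bounded_linear_Blinfun_apply bounded_linear_compose[OF bounded_linear_scaleC]
      blinfun.bounded_linear_right scaleC_scaleC mult.commute)

lemma bop_apply_zero: "bop_apply 0 x = 0"
  by transfer simp
lemma bop_apply_add: "bop_apply (a + b) x = bop_apply a x + bop_apply b x"
  by transfer (simp add: blinfun.add_left)
lemma bop_apply_diff: "bop_apply (a - b) x = bop_apply a x - bop_apply b x"
  by transfer (simp add: blinfun.diff_left)
lemma bop_apply_minus: "bop_apply (- a) x = - bop_apply a x"
  by transfer (simp add: blinfun.minus_left)
lemma bop_apply_scaleR: "bop_apply (r *\<^sub>R a) x = r *\<^sub>R bop_apply a x"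
  by transfer (simp add: blinfun.scaleR_left)
lemma bop_apply_scaleC: "bop_apply (c *\<^sub>C a) x = c *\<^sub>C bop_apply a x"
  by transfer (simp add: bounded_linear_Blinfun_apply
      bounded_linear_compose[OF bounded_linear_scaleC] blinfun.bounded_linear_right)

lemmas bop_apply_simps = bop_apply_zero bop_apply_add bop_apply_diff bop_apply_minus
  bop_apply_scaleR bop_apply_scaleC

instance
proof
  fix a b c :: "'a bop" and r s :: real and z w :: complex
  show "a + b + c = a + (b + c)" "a + b = b + a" "0 + a = a" "- a + a = 0" "a - b = a + - b"
    by (rule bop_eqI, simp add: bop_apply_simps)+
  show "r *\<^sub>R (a + b) = r *\<^sub>R a + r *\<^sub>R b" "(r + s) *\<^sub>R a = r *\<^sub>R a + s *\<^sub>R a"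
    "r *\<^sub>R s *\<^sub>R a = (r * s) *\<^sub>R a" "1 *\<^sub>R a = a"
    by (rule bop_eqI, simp add: bop_apply_simps scaleR_add_left scaleR_add_right)+
  show "z *\<^sub>C (a + b) = z *\<^sub>C a + z *\<^sub>C b" "(z + w) *\<^sub>C a = z *\<^sub>C a + w *\<^sub>C a"
    "z *\<^sub>C w *\<^sub>C a = (z * w) *\<^sub>C a" "1 *\<^sub>C a = a"
    by (rule bop_eqI, simp add: bop_apply_simps scaleC_add_left scaleC_add_right scaleC_scaleC
        scaleC_one)+
  show "r *\<^sub>R a = complex_of_real r *\<^sub>C a"
    by (rule bop_eqI) (simp add: bop_apply_simps scaleR_scaleC)
qed

end

instantiation bop :: (complex_hilbert) real_normed_vector
begin

lift_definition norm_bop :: "'a bop \<Rightarrow> real" is norm .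
definition dist_bop :: "'a bop \<Rightarrow> 'a bop \<Rightarrow> real" where
  "dist_bop a b = norm (a - b)"
definition sgn_bop :: "'a bop \<Rightarrow> 'a bop" where
  "sgn_bop a = inverse (norm a) *\<^sub>R a"
definition uniformity_bop :: "('a bop \<times> 'a bop) filter" where
  "uniformity_bop = (INF e\<in>{0 <..}. principal {(a, b). dist a b < e})"
definition open_bop :: "'a bop set \<Rightarrow> bool" where
  "open_bop S = (\<forall>a\<in>S. \<forall>\<^sub>F (a', b) in uniformity. a' = a \<longrightarrow> b \<in> S)"

instance
proof
  fix a b :: "'a bop" and r :: real
  show "dist a b = norm (a - b)"
    by (rule dist_bop_def)
  show "sgn a = inverse (norm a) *\<^sub>R a"
    by (rule sgn_bop_def)
  show "uniformity = (INF e\<in>{0 <..}. principal {(a, b :: 'a bop). dist a b < e})"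
    by (rule uniformity_bop_def)
  show "open S \<longleftrightarrow> (\<forall>a\<in>S. \<forall>\<^sub>F (a', b) in uniformity. a' = a \<longrightarrow> b \<in> S)" for S :: "'a bop set"
    by (rule open_bop_def)
  show "norm a = 0 \<longleftrightarrow> a = 0"
    by transfer simp
  show "norm (a + b) \<le> norm a + norm b"
    by transfer (rule norm_triangle_ineq)
  show "norm (r *\<^sub>R a) = \<bar>r\<bar> * norm a"
    by transfer simp
qed

end

text \<open>Multiplication is composition. The class of rings with unit is not available because
  \<open>0 = 1\<close> on the trivial space.\<close>

instantiation bop :: (complex_hilbert) "{real_normed_algebra, monoid_mult}"
begin

lift_definition one_bop :: "'a bop" is id_blinfun
  by simp
lift_definition times_bop :: "'a bop \<Rightarrow> 'a bop \<Rightarrow> 'a bop" is blinfun_compose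
  by simp

lemma bop_apply_one: "bop_apply 1 x = x"
  by transfer simp
lemma bop_apply_mult: "bop_apply (a * b) x = bop_apply a (bop_apply b x)"
  by transfer simp
lemma bop_apply_arg_add: "bop_apply a (x + y) = bop_apply a x + bop_apply a y"
  by transfer (rule blinfun.add_right)
lemma bop_apply_arg_scaleR: "bop_apply a (r *\<^sub>R x) = r *\<^sub>R bop_apply a x"
  by transfer (rule blinfun.scaleR_right)

instance
proof
  fix a b c :: "'a bop" and r :: real
  show "a * b * c = a * (b * c)" "1 * a = a" "a * 1 = a"
    by (rule bop_eqI, simp add: bop_apply_one bop_apply_mult)+
  show "(a + b) * c = a * c + b * c" "a * (b + c) = a * b + a * c"
    "r *\<^sub>R a * b = r *\<^sub>R (a * b)" "a * r *\<^sub>R b = r *\<^sub>R (a * b)"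
    by (rule bop_eqI, simp add: bop_apply_mult bop_apply_simps bop_apply_arg_add
        bop_apply_arg_scaleR)+
  show "norm (a * b) \<le> norm a * norm b"
    by transfer (rule norm_blinfun_compose)
qed

end

text \<open>The adjoint exists and is unique by the Riesz representation theorem.\<close>

definition adj :: "'a::complex_hilbert bop \<Rightarrow> 'a bop" where
  "adj a = (THE b. \<forall>x y. cinner (bop_apply a x) y = cinner x (bop_apply b y))"

definition normal_op :: "'a::complex_hilbert bop \<Rightarrow> bool" where
  "normal_op a \<longleftrightarrow> adj a * a = a * adj a"

definition projection :: "'a::complex_hilbert bop \<Rightarrow> bool" where
  "projection e \<longleftrightarrow> adj e = e \<and> e * e = e"

definition poly_op :: "complex poly \<Rightarrow> 'a::complex_hilbert bop \<Rightarrow> 'a bop" where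
  "poly_op p a = (\<Sum>i\<le>degree p. coeff p i *\<^sub>C a ^ i)"

definition algebraic_op :: "'a::complex_hilbert bop \<Rightarrow> bool" where
  "algebraic_op a \<longleftrightarrow> (\<exists>p. p \<noteq> 0 \<and> poly_op p a = 0)"

definition finite_rank :: "'a::complex_hilbert bop \<Rightarrow> bool" where
  "finite_rank a \<longleftrightarrow> (\<exists>B. finite B \<and> range (bop_apply a) = cspan B)"

text \<open>The library's \<open>dim\<close> is \<open>0\<close> on infinite-dimensional spaces, so \<open>op_rank a = r\<close> has its usual
  meaning for positive \<open>r\<close>.\<close>

definition op_rank :: "'a::complex_hilbert bop \<Rightarrow> nat" where
  "op_rank a = cdim (range (bop_apply a))"


section \<open>Automorphisms\<close>

definition star_automorphism :: "('a::complex_hilbert bop \<Rightarrow> 'a bop) \<Rightarrow> bool" where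
  "star_automorphism f \<longleftrightarrow> bij f \<and>
     (\<forall>a b. f (a + b) = f a + f b) \<and>
     (\<forall>c a. f (c *\<^sub>C a) = c *\<^sub>C f a) \<and>
     (\<forall>a b. f (a * b) = f a * f b) \<and>
     (\<forall>a. f (adj a) = adj (f a))"

text \<open>Automorphisms of a $C^*$-algebra are isometric, so nothing is lost by regarding them as
  bounded linear maps. This is what gives the automorphism group its topology, the one of the
  operator norm.\<close>

definition Aut :: "('a::complex_hilbert bop \<Rightarrow>\<^sub>L 'a bop) set" where
  "Aut = {\<Phi>. star_automorphism (blinfun_apply \<Phi>)}"

definition Aut0 :: "('a::complex_hilbert bop \<Rightarrow>\<^sub>L 'a bop) set" where
  "Aut0 = connected_component_set Aut id_blinfun"


section \<open>The sets of normal algebraic elements\<close>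

definition normal_algebraic_finite_rank :: "'a::complex_hilbert bop set" where
  "normal_algebraic_finite_rank = {a. a \<noteq> 0 \<and> normal_op a \<and> algebraic_op a \<and> finite_rank a}"

text \<open>Tuples are lists, hence indexed from \<open>0\<close>.\<close>

definition parameters :: "nat \<Rightarrow> complex list \<Rightarrow> nat list \<Rightarrow> bool" where
  "parameters n \<Lambda> R \<longleftrightarrow> 0 < n \<and>
     length \<Lambda> = n \<and> distinct \<Lambda> \<and> (\<forall>k<n. \<Lambda> ! k \<noteq> 0) \<and>
     length R = n \<and> (\<forall>k<n. 0 < R ! k)"

definition M :: "nat \<Rightarrow> complex list \<Rightarrow> nat list \<Rightarrow> 'a::complex_hilbert bop set" where
  "M n \<Lambda> R = {\<Sum>k<n. \<Lambda> ! k *\<^sub>C e k | e.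
     (\<forall>k<n. projection (e k) \<and> op_rank (e k) = R ! k) \<and>
     (\<forall>j<n. \<forall>k<n. j \<noteq> k \<longrightarrow> e j * e k = 0)}"

definition same_up_to_permutation ::
    "nat \<times> complex list \<times> nat list \<Rightarrow> nat \<times> complex list \<times> nat list \<Rightarrow> bool" where
  "same_up_to_permutation = (\<lambda>(n, \<Lambda>, R) (n', \<Lambda>', R'). n' = n \<and>
     (\<exists>\<pi>. \<pi> permutes {..<n} \<and> \<Lambda>' = permute_list \<pi> \<Lambda> \<and> R' = permute_list \<pi> R))"

end

theory Submission
  imports Defs "HOL-Computational_Algebra.Fundamental_Theorem_Algebra"
begin

text \<open>For a normal operator \<open>a\<close> annihilated by a polynomial \<open>p\<close>, the operator \<open>q(a)\<close> depends only on
  the values of \<open>q\<close> at the roots of \<open>p\<close>, because normal nilpotents vanish. Lagrange interpolation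
  at these roots yields the spectral projections, and the parameters are read off as the non-zero
  eigenvalues and the dimensions of the eigenspaces. Automorphisms preserve the rank of a
  projection since rank-one projections are the minimal ones (\<open>p a p \<in> \<complex> p\<close> for all \<open>a\<close>).
  For transitivity, one orthonormal family is carried to another by a product of complex
  Householder reflections \<open>1 + (c - 1) \<langle>\<cdot>, v\<rangle> v\<close>; letting \<open>c\<close> run through the unit circle connects
  each of them to \<open>1\<close>. Connectedness follows, an orbit being a continuous image of the identity
  component.\<close>

section \<open>Inner products and adjoints\<close>

lemma cinner_add_right: "cinner x (y + z) = cinner x y + cinner (x :: 'a::complex_hilbert) z"
  by (metis cinner_add_left cinner_commute complex_cnj_add)

lemma cinner_scaleC_right: "cinner x (c *\<^sub>C y) = cnj c * cinner (x :: 'a::complex_hilbert) y"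
  by (metis cinner_commute cinner_scaleC_left complex_cnj_mult)

lemma cinner_zero_left [simp]: "cinner 0 (x :: 'a::complex_hilbert) = 0"
  using cinner_add_left[of 0 0 x] by simp

lemma cinner_zero_right [simp]: "cinner (x :: 'a::complex_hilbert) 0 = 0"
  using cinner_add_right[of x 0 0] by simp

lemma cinner_minus_left: "cinner (- x) y = - cinner (x :: 'a::complex_hilbert) y"
  using cinner_add_left[of x "- x" y] by (simp add: eq_neg_iff_add_eq_0 add.commute)

lemma cinner_minus_right: "cinner x (- y) = - cinner (x :: 'a::complex_hilbert) y"
  using cinner_add_right[of x y "- y"] by (simp add: eq_neg_iff_add_eq_0 add.commute)

lemma cinner_diff_left: "cinner (x - y) z = cinner x z - cinner (y :: 'a::complex_hilbert) z"
  using cinner_add_left[of x "- y" z] by (simp add: cinner_minus_left)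

lemma cinner_diff_right: "cinner x (y - z) = cinner x y - cinner (x :: 'a::complex_hilbert) z"
  using cinner_add_right[of x y "- z"] by (simp add: cinner_minus_right)

lemma cinner_scaleR_left: "cinner (r *\<^sub>R x) y = of_real r * cinner (x :: 'a::complex_hilbert) y"
  by (simp add: scaleR_scaleC cinner_scaleC_left)

lemma cinner_scaleR_right: "cinner x (r *\<^sub>R y) = of_real r * cinner (x :: 'a::complex_hilbert) y"
  by (simp add: scaleR_scaleC cinner_scaleC_right)

lemmas cinner_simps = cinner_add_left cinner_add_right cinner_diff_left cinner_diff_right
  cinner_minus_left cinner_minus_right cinner_scaleC_left cinner_scaleC_right
  cinner_scaleR_left cinner_scaleR_right

lemma cinner_self: "cinner x x = complex_of_real ((norm (x :: 'a::complex_hilbert))\<^sup>2)"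
proof -
  have "cinner x x \<in> \<real>"
    by (metis cinner_commute Reals_cnj_iff)
  then show ?thesis
    by (simp add: norm_eq_sqrt_cinner cinner_ge_zero complex_is_Real_iff complex_eq_iff)
qed

lemma norm_add_sq:
  "(norm (x + y :: 'a::complex_hilbert))\<^sup>2 = (norm x)\<^sup>2 + 2 * Re (cinner x y) + (norm y)\<^sup>2"
proof -
  have "complex_of_real ((norm (x + y))\<^sup>2) = cinner (x + y) (x + y)"
    by (simp add: cinner_self)
  also have "\<dots> = cinner x x + (cinner x y + cnj (cinner x y)) + cinner y y"
    by (simp add: cinner_simps cinner_commute[of y x])
  also have "\<dots> = of_real ((norm x)\<^sup>2 + 2 * Re (cinner x y) + (norm y)\<^sup>2)"
    by (simp add: complex_add_cnj cinner_self)
  finally show ?thesis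
    by (simp only: of_real_eq_iff)
qed

lemma Cauchy_Schwarz_cinner: "cmod (cinner x y) \<le> norm x * norm (y :: 'a::complex_hilbert)"
proof (cases "y = 0")
  case False
  define N where "N = (norm y)\<^sup>2"
  define c where "c = cinner x y"
  have N: "N > 0" using False by (simp add: N_def)
  have y: "cinner y y = of_real N" and x: "cinner x x = of_real ((norm x)\<^sup>2)"
    by (simp_all add: cinner_self N_def)
  have yx: "cinner y x = cnj c" by (simp add: c_def cinner_commute[of y x])
  \<comment> \<open>\<open>w\<close> is \<open>N\<close> times the component of \<open>x\<close>
    orthogonal to \<open>y\<close>. The scaling avoids a division, and positivity of \<langle>w,
    w\<rangle> is the claim multiplied by \<open>N\<close>.\<close>
  define w where "w = of_real N *\<^sub>C x - c *\<^sub>C y"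
  have "cinner w w = of_real N * (of_real N * of_real ((norm x)\<^sup>2) - c * cnj c)"
    unfolding w_def by (simp add: cinner_simps x y yx c_def[symmetric] algebra_simps)
  also have "\<dots> = of_real (N * (N * (norm x)\<^sup>2 - (cmod c)\<^sup>2))"
    by (simp add: complex_norm_square[symmetric] del: of_real_power)
  finally have "0 \<le> N * (N * (norm x)\<^sup>2 - (cmod c)\<^sup>2)"
    using cinner_ge_zero[of w] by simp
  then have "(cmod c)\<^sup>2 \<le> N * (norm x)\<^sup>2"
    using N by (simp add: zero_le_mult_iff)
  also have "\<dots> = (norm x * norm y)\<^sup>2"
    by (simp add: N_def power_mult_distrib)
  finally show ?thesis
    unfolding c_def by (rule power2_le_imp_le) simp
qed simp

lemma norm_scaleC: "norm (c *\<^sub>C (x :: 'a::complex_hilbert)) = cmod c * norm x"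
proof -
  have "complex_of_real ((norm (c *\<^sub>C x))\<^sup>2) = c * cnj c * cinner x x"
    unfolding cinner_self[symmetric] by (simp add: cinner_simps mult.assoc)
  also have "\<dots> = of_real ((cmod c * norm x)\<^sup>2)"
    by (simp add: cinner_self power_mult_distrib complex_norm_square[symmetric] del: of_real_power)
  finally have "complex_of_real ((norm (c *\<^sub>C x))\<^sup>2) = of_real ((cmod c * norm x)\<^sup>2)" .
  then show ?thesis
    by (simp only: of_real_eq_iff) simp
qed

lemma cinner_ext: "(\<And>x. cinner x y = cinner x (z :: 'a::complex_hilbert)) \<Longrightarrow> y = z"
  using cinner_eq_zero_iff[of "y - z"] by (simp add: cinner_diff_right)

section \<open>Operators as linear maps, and how to construct them\<close>

lemma bop_apply_arg_scaleC: "bop_apply a (c *\<^sub>C x) = c *\<^sub>C bop_apply a x"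
  by transfer simp

lemma bounded_linear_bop_apply: "bounded_linear (bop_apply a)"
  by transfer (rule blinfun.bounded_linear_right)

lemma bop_apply_arg_zero [simp]: "bop_apply a 0 = 0"
  by (rule linear_simps(3)[OF bounded_linear_bop_apply])

lemma bop_apply_arg_diff: "bop_apply a (x - y) = bop_apply a x - bop_apply a y"
  by (rule linear_simps(2)[OF bounded_linear_bop_apply])

lemma bop_apply_arg_sum: "bop_apply a (\<Sum>i\<in>I. f i) = (\<Sum>i\<in>I. bop_apply a (f i))"
  by (rule linear_sum[OF bounded_linear.linear[OF bounded_linear_bop_apply]])

lemmas bop_apply_arg_simps = bop_apply_arg_add bop_apply_arg_diff bop_apply_arg_scaleC
  bop_apply_arg_scaleR

lemma bop_apply_sum: "bop_apply (\<Sum>i\<in>I. f i) x = (\<Sum>i\<in>I. bop_apply (f i) x)"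
  by (induction I rule: infinite_finite_induct) (simp_all add: bop_apply_simps)

lemma norm_bop_apply: "norm (bop_apply a x) \<le> norm a * norm x"
  by transfer (rule norm_blinfun)

text \<open>The entry point for new operators: adjoints and rank-one operators are obtained from it.
  Real homogeneity comes from complex homogeneity, real scalars being complex ones.\<close>

lemma ex_bop:
  fixes f :: "'a::complex_hilbert \<Rightarrow> 'a"
  assumes "\<And>x y. f (x + y) = f x + f y" and "\<And>c x. f (c *\<^sub>C x) = c *\<^sub>C f x"
    and "\<And>x. norm (f x) \<le> norm x * K"
  shows "\<exists>a. bop_apply a = f"
proof -
  have "bounded_linear f"
    using assms by (intro bounded_linear_intro[of _ K]) (simp_all add: scaleR_scaleC)
  then have "blinfun_apply (Blinfun f) = f"
    by (rule bounded_linear_Blinfun_apply)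
  then have "bop_apply (Bop (Blinfun f)) = f"
    using assms(2) by (simp add: bop_apply.rep_eq Bop_inverse)
  then show ?thesis ..
qed

text \<open>The representing vector minimises \<open>\<parallel>x\<parallel>\<^sup>2 - 2 Re (f x)\<close>; by the parallelogram law minimising
  sequences are Cauchy.\<close>

theorem Riesz_representation:
  fixes f :: "'a::complex_hilbert \<Rightarrow> complex"
  assumes f: "bounded_linear f" and fC: "\<And>c x. f (c *\<^sub>C x) = c * f x"
  shows "\<exists>z. \<forall>x. f x = cinner x z"
proof -
  interpret f: bounded_linear f by (rule f)
  obtain K where K: "\<And>x. cmod (f x) \<le> norm x * K" using f.bounded by blast
  \<comment> \<open>If \<open>f\<close> is \<langle>\<cdot>, z\<rangle>, then \<open>J x\<close>
    equals \<parallel>x - z\<parallel> squared minus the constant \<parallel>z\<parallel> squared,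
    so its minimum sits exactly at \<open>z\<close>.\<close>
  define J where "J x = (norm x)\<^sup>2 - 2 * Re (f x)" for x
  have bound: "- K\<^sup>2 \<le> J x" for x
  proof -
    have "Re (f x) \<le> norm x * K" using K[of x] complex_Re_le_cmod[of "f x"] by linarith
    moreover have "0 \<le> (norm x - K)\<^sup>2" by simp
    ultimately show ?thesis by (simp add: J_def power2_eq_square algebra_simps)
  qed
  define m where "m = (INF x. J x)"
  have bdd: "bdd_below (range J)" using bound by (intro bdd_belowI2)
  have m: "m \<le> J x" for x unfolding m_def by (rule cINF_lower[OF bdd]) simp
  have "\<exists>x. J x < m + 1 / Suc n" for n
    using cINF_less_iff[OF _ bdd, of "m + 1 / Suc n"] by (simp add: m_def)
  then obtain X where X: "\<And>n. J (X n) < m + 1 / Suc n" by metis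
  \<comment> \<open>The linear parts of \<open>J\<close> cancel in this combination; what remains is
    the parallelogram law.\<close>
  have par: "(norm (x - y))\<^sup>2 = 2 * J x + 2 * J y - 4 * J ((1/2) *\<^sub>R (x + y))" for x y
  proof -
    have "4 * J ((1/2) *\<^sub>R (x + y)) = (norm (x + y))\<^sup>2 - 4 * (Re (f x) + Re (f y))"
      unfolding J_def f.scaleR f.add norm_scaleR by (simp add: power_divide field_simps)
    then show ?thesis
      using norm_add_sq[of x y] norm_add_sq[of x "- y"] by (simp add: J_def cinner_minus_right)
  qed
  have close: "(norm (x - y))\<^sup>2 \<le> 2 * (J x - m) + 2 * (J y - m)" for x y
    using par[of x y] m[of "(1/2) *\<^sub>R (x + y)"] by simp
  have "Cauchy X"
  proof (rule metric_CauchyI)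
    fix e :: real assume e: "e > 0"
    obtain N where N: "1 / Suc N < e\<^sup>2 / 4"
      using reals_Archimedean[of "e\<^sup>2 / 4"] e by (auto simp: inverse_eq_divide)
    define d where "d = 1 / Suc N"
    have J: "J (X k) < m + d" if "k \<ge> N" for k
    proof -
      have "1 / Suc k \<le> d" using that by (simp add: d_def frac_le)
      then show ?thesis using X[of k] by linarith
    qed
    have "dist (X i) (X j) < e" if "i \<ge> N" "j \<ge> N" for i j
    proof -
      have "2 * (J (X i) - m) + 2 * (J (X j) - m) < e\<^sup>2"
        using J[OF that(1)] J[OF that(2)] N[folded d_def] by argo
      with close[of "X i" "X j"] have "(norm (X i - X j))\<^sup>2 < e\<^sup>2"
        by (rule le_less_trans)
      then show ?thesis
        unfolding dist_norm using e by (intro power2_less_imp_less[of _ e]) auto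
    qed
    then show "\<exists>M. \<forall>i\<ge>M. \<forall>j\<ge>M. dist (X i) (X j) < e" by blast
  qed
  then obtain z where z: "X \<longlonglongrightarrow> z"
    using Cauchy_convergent convergent_def by blast
  have "(\<lambda>n. J (X n)) \<longlonglongrightarrow> J z"
    unfolding J_def by (intro tendsto_intros z f.tendsto)
  moreover have "(\<lambda>n. m + 1 / Suc n) \<longlonglongrightarrow> m + 0"
    using LIMSEQ_inverse_real_of_nat_add[of m] by (simp add: inverse_eq_divide)
  ultimately have "J z \<le> m + 0"
    using X by (intro LIMSEQ_le) (auto intro: less_imp_le)
  then have min: "J z \<le> J x" for x using m[of x] by simp
  have Re: "Re (cinner z h) = Re (f h)" for h
  proof -
    define d where "d = 2 * (Re (cinner z h) - Re (f h))"
    \<comment> \<open>Minimality of \<open>J\<close> at \<open>z\<close> along the line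
      \<open>z + t h\<close>. The first-order coefficient \<open>d\<close> has to vanish.\<close>
    have q: "0 \<le> t * d + t\<^sup>2 * (norm h)\<^sup>2" for t
      using min[of "z + t *\<^sub>R h"] norm_add_sq[of z "t *\<^sub>R h"]
      by (simp add: J_def f.add f.scaleR cinner_simps power_mult_distrib d_def algebra_simps)
    have "d = 0"
    proof (rule ccontr)
      assume d: "d \<noteq> 0"
      \<comment> \<open>The test value \<open>t = - d / P\<close> makes the quadratic negative
        unless \<open>d = 0\<close>; adding 1 keeps \<open>P\<close> positive even for
        \<open>h = 0\<close>.\<close>
      define P where "P = 1 + (norm h)\<^sup>2"
      have P: "P > 0" "(norm h)\<^sup>2 = P - 1" by (auto simp: P_def add_pos_nonneg)
      have "0 \<le> (- d / P) * d + (- d / P)\<^sup>2 * (P - 1)" using q[of "- d / P"] P by simp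
      also have "\<dots> = - (d / P)\<^sup>2" using P(1) by (simp add: field_simps power2_eq_square)
      finally show False using d P(1) by simp
    qed
    then show ?thesis by (simp add: d_def)
  qed
  have "f x = cinner x z" for x
  proof (rule complex_eqI)
    show "Re (f x) = Re (cinner x z)"
      using Re[of x] cinner_commute[of x z] by simp
    \<comment> \<open>The imaginary part at \<open>x\<close> is minus the real part at \<i>x, so the
      identity of real parts suffices.\<close>
    show "Im (f x) = Im (cinner x z)"
      using Re[of "\<i> *\<^sub>C x"] by (simp add: fC cinner_simps cinner_commute[of x z])
  qed
  then show ?thesis by blast
qed

section \<open>Existence and algebra of the adjoint\<close>

lemma ex_adjoint: "\<exists>b. \<forall>x y. cinner (bop_apply a x) y = cinner x (bop_apply b y)"
proof -
  have "\<exists>z. \<forall>x. cinner (bop_apply a x) y = cinner x z" for y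
  proof (rule Riesz_representation)
    show "bounded_linear (\<lambda>x. cinner (bop_apply a x) y)"
    proof (rule bounded_linear_intro[where K = "norm a * norm y"])
      fix x
      have "norm (cinner (bop_apply a x) y) \<le> norm (bop_apply a x) * norm y"
        by (rule Cauchy_Schwarz_cinner)
      also have "\<dots> \<le> (norm a * norm x) * norm y"
        by (intro mult_right_mono norm_bop_apply) simp
      finally show "norm (cinner (bop_apply a x) y) \<le> norm x * (norm a * norm y)"
        by (simp add: mult_ac)
    qed (simp_all add: bop_apply_arg_simps cinner_simps scaleR_conv_of_real)
  qed (simp add: bop_apply_arg_simps cinner_simps)
  then obtain g where g: "\<And>x y. cinner (bop_apply a x) y = cinner x (g y)"
    by metis
  have "\<exists>b. bop_apply b = g"
  proof (rule ex_bop)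
    show "g (x + y) = g x + g y" for x y
      by (rule cinner_ext) (simp add: g[symmetric] cinner_simps)
    show "g (c *\<^sub>C x) = c *\<^sub>C g x" for c x
      by (rule cinner_ext) (simp add: g[symmetric] cinner_simps)
    \<comment> \<open>Testing the defining identity at \<open>x = g y\<close> bounds the square of
      \<parallel>g y\<parallel> by \<parallel>a\<parallel> \<parallel>g y\<parallel>
      \<parallel>y\<parallel>.\<close>
    show "norm (g y) \<le> norm y * norm a" for y
    proof (cases "g y = 0")
      case False
      have "(norm (g y))\<^sup>2 = cmod (cinner (bop_apply a (g y)) y)"
        by (simp add: g cinner_self norm_power)
      also have "\<dots> \<le> norm (bop_apply a (g y)) * norm y"
        by (rule Cauchy_Schwarz_cinner)
      also have "\<dots> \<le> (norm a * norm (g y)) * norm y"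
        by (intro mult_right_mono norm_bop_apply) simp
      finally show ?thesis
        using False by (simp add: power2_eq_square mult_ac)
    qed simp
  qed
  then show ?thesis
    using g by auto
qed

text \<open>Inner products separate vectors, so the definite description has at most one candidate.
  Every later computation of an adjoint goes through this rule.\<close>

lemma adj_eqI:
  assumes "\<And>x y. cinner (bop_apply a x) y = cinner x (bop_apply b y)"
  shows "adj a = b"
  unfolding adj_def
proof (rule the_equality)
  fix c assume "\<forall>x y. cinner (bop_apply a x) y = cinner x (bop_apply c y)"
  with assms show "c = b"
    by (intro bop_eqI cinner_ext) metis
qed (use assms in blast)

lemma cinner_adj_right: "cinner x (bop_apply (adj a) y) = cinner (bop_apply a x) y"
  using ex_adjoint[of a] adj_eqI[of a] by metis

lemma cinner_adj_left: "cinner (bop_apply (adj a) x) y = cinner x (bop_apply a y)"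
  by (metis cinner_adj_right cinner_commute)

lemma adj_adj [simp]: "adj (adj a) = a"
  by (rule adj_eqI) (rule cinner_adj_left)

lemma adj_mult: "adj (a * b) = adj b * adj a"
  by (rule adj_eqI) (simp add: bop_apply_mult cinner_adj_right)

lemma adj_add: "adj (a + b) = adj a + adj b"
  by (rule adj_eqI) (simp add: bop_apply_simps cinner_simps cinner_adj_right)

lemma adj_scaleC: "adj (c *\<^sub>C a) = cnj c *\<^sub>C adj a"
  by (rule adj_eqI) (simp add: bop_apply_simps cinner_simps cinner_adj_right)

lemma adj_one [simp]: "adj 1 = 1"
  by (rule adj_eqI) (simp add: bop_apply_one)

lemma adj_zero [simp]: "adj 0 = 0"
  by (rule adj_eqI) (simp add: bop_apply_simps)

lemma adj_sum: "adj (\<Sum>i\<in>I. f i) = (\<Sum>i\<in>I. adj (f i))"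
  by (induction I rule: infinite_finite_induct) (simp_all add: adj_add)

lemma mult_scaleC_left: "(c *\<^sub>C a) * b = c *\<^sub>C (a * b :: 'a::complex_hilbert bop)"
  by (rule bop_eqI) (simp add: bop_apply_simps bop_apply_mult)

lemma mult_scaleC_right: "a * (c *\<^sub>C b) = c *\<^sub>C (a * b :: 'a::complex_hilbert bop)"
  by (rule bop_eqI) (simp add: bop_apply_simps bop_apply_mult bop_apply_arg_scaleC)

lemmas mult_scaleC = mult_scaleC_left mult_scaleC_right

section \<open>Rank-one operators and finite-rank projections\<close>

lemma subspace_range_bop_apply: "complex_vector.subspace (range (bop_apply a))"
proof (rule complex_vector.subspaceI)
  show "0 \<in> range (bop_apply a)"
    by (metis bop_apply_arg_zero rangeI)
  show "x + y \<in> range (bop_apply a)"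
    if "x \<in> range (bop_apply a)" "y \<in> range (bop_apply a)" for x y
    using that by (auto simp: bop_apply_arg_add[symmetric])
  show "c *\<^sub>C x \<in> range (bop_apply a)" if "x \<in> range (bop_apply a)" for c x
    using that by (auto simp: bop_apply_arg_scaleC[symmetric])
qed

text \<open>Weakens the equality in \<open>finite_rank\<close> to an inclusion: a maximal
  independent subset of the range spans it, and it is finite because it lies in a finitely spanned
  space.\<close>

lemma finite_rankI:
  assumes "finite B" and sub: "range (bop_apply a) \<subseteq> cspan B"
  shows "finite_rank a"
proof -
  obtain C where C: "C \<subseteq> range (bop_apply a)" "complex_vector.independent C"
      "range (bop_apply a) \<subseteq> cspan C"
    using complex_vector.maximal_independent_subset by blast
  have "finite C"
    using complex_vector.independent_span_bound[OF assms(1) C(2)] C(1) sub by blast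
  moreover have "range (bop_apply a) = cspan C"
    using C complex_vector.span_minimal[OF C(1) subspace_range_bop_apply] by blast
  ultimately show ?thesis
    unfolding finite_rank_def by blast
qed

text \<open>\<open>card\<close> is 0 on infinite sets, so a basis whose cardinality is a positive
  number must be finite.\<close>

lemma finite_rank_if_op_rank_pos:
  assumes "op_rank a > 0"
  shows "finite_rank a"
proof -
  obtain B where B: "range (bop_apply a) \<subseteq> cspan B" "card B = op_rank a"
    using complex_vector.basis_exists[of "range (bop_apply a)"] unfolding op_rank_def by metis
  then have "finite B"
    using assms card_gt_0_iff by metis
  then show ?thesis
    using B finite_rankI by blast
qed

text \<open>For a unit vector this is the orthogonal projection onto its line. The choice is
  unambiguous, since an operator is determined by its values.\<close>

definition dyad :: "'a::complex_hilbert \<Rightarrow> 'a bop" where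
  "dyad x = (SOME a. bop_apply a = (\<lambda>z. cinner z x *\<^sub>C x))"

lemma bop_apply_dyad: "bop_apply (dyad x) z = cinner z x *\<^sub>C x"
proof -
  have "\<exists>a. bop_apply a = (\<lambda>z. cinner z x *\<^sub>C x)"
  proof (rule ex_bop)
    show "norm (cinner z x *\<^sub>C x) \<le> norm z * (norm x * norm x)" for z
      using mult_right_mono[OF Cauchy_Schwarz_cinner[of z x], of "norm x"]
      by (simp add: norm_scaleC mult.assoc)
  qed (simp_all add: cinner_simps scaleC_add_left scaleC_scaleC)
  then have "bop_apply (dyad x) = (\<lambda>z. cinner z x *\<^sub>C x)"
    unfolding dyad_def by (rule someI_ex)
  then show ?thesis by simp
qed

lemma adj_dyad [simp]: "adj (dyad x) = dyad x"
  by (rule adj_eqI) (simp add: bop_apply_dyad cinner_simps cinner_commute[of x])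

text \<open>Conjugation acts on dyads by moving the vector. Applied to a unitary it drives
  transitivity; applied to a projection it drives the minimality argument below.\<close>

lemma conj_dyad: "a * dyad x * adj a = dyad (bop_apply a x)"
  by (rule bop_eqI) (simp add: bop_apply_mult bop_apply_dyad cinner_adj_left bop_apply_arg_scaleC)

lemma dyad_mult_dyad: "dyad x * dyad y = 0" if "cinner y x = 0"
  by (rule bop_eqI) (simp add: bop_apply_mult bop_apply_dyad bop_apply_zero cinner_simps that
      complex_vector.scale_zero_left complex_vector.scale_zero_right)

lemma dyad_idem: "norm x = 1 \<Longrightarrow> dyad x * dyad x = dyad x"
  by (rule bop_eqI) (simp add: bop_apply_mult bop_apply_dyad cinner_simps cinner_self)

lemma dyad_compress: "dyad x * a * dyad x = cinner (bop_apply a x) x *\<^sub>C dyad x"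
  by (rule bop_eqI)
    (simp add: bop_apply_mult bop_apply_dyad bop_apply_simps bop_apply_arg_scaleC cinner_simps
      scaleC_scaleC)

lemma ex_unit_multiple:
  fixes x :: "'a::complex_hilbert"
  assumes "x \<noteq> 0"
  shows "\<exists>c. norm (c *\<^sub>C x) = 1"
  using assms by (intro exI[of _ "of_real (1 / norm x)"]) (simp add: norm_scaleC norm_divide)

text \<open>The right-hand side mentions only products, adjoints and scalars, hence is invariant
  under automorphisms. For the converse, a unit vector \<open>x\<close> in the range of
  \<open>p\<close> satisfies \<open>p * dyad x * p = dyad x\<close>, so \<open>dyad x\<close> is a
  multiple of \<open>p\<close>, and evaluating at \<open>x\<close> shows the factor to be 1.\<close>

lemma rank_one_projection_iff:
  "(\<exists>x. norm x = 1 \<and> p = dyad x) \<longleftrightarrow>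
    projection p \<and> p \<noteq> 0 \<and> (\<forall>a. \<exists>c. p * a * p = c *\<^sub>C p)"
proof
  assume "\<exists>x. norm x = 1 \<and> p = dyad x"
  then obtain x where x: "norm x = 1" and p: "p = dyad x" by blast
  have "bop_apply p x \<noteq> 0"
    using x by (auto simp: p bop_apply_dyad cinner_self)
  then have "p \<noteq> 0"
    by (auto simp: bop_apply_zero)
  then show "projection p \<and> p \<noteq> 0 \<and> (\<forall>a. \<exists>c. p * a * p = c *\<^sub>C p)"
    unfolding p projection_def dyad_compress using x by (auto simp: dyad_idem)
next
  assume "projection p \<and> p \<noteq> 0 \<and> (\<forall>a. \<exists>c. p * a * p = c *\<^sub>C p)"
  then have p: "adj p = p" "p * p = p" "p \<noteq> 0" and c: "\<And>a. \<exists>c. p * a * p = c *\<^sub>C p"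
    by (auto simp: projection_def)
  obtain z where "bop_apply p z \<noteq> 0"
    using p(3) by (metis bop_eqI bop_apply_zero)
  then obtain d where d: "norm (d *\<^sub>C bop_apply p z) = 1"
    using ex_unit_multiple by blast
  define x where "x = d *\<^sub>C bop_apply p z"
  have x: "norm x = 1" using d by (simp add: x_def)
  have px: "bop_apply p x = x"
    using p(2) by (simp add: x_def bop_apply_arg_scaleC bop_apply_mult[symmetric])
  obtain c where "p * dyad x * p = c *\<^sub>C p" using c by blast
  moreover have "p * dyad x * p = dyad x"
    using conj_dyad[of p x] by (simp add: p px)
  ultimately have *: "dyad x = c *\<^sub>C p" by simp
  have "x = c *\<^sub>C x"
    using arg_cong[OF *, of "\<lambda>a. bop_apply a x"] x
    by (simp add: bop_apply_dyad bop_apply_simps px cinner_self scaleC_one)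
  then have "(1 - c) *\<^sub>C x = 0"
    by (simp add: complex_vector.scale_left_diff_distrib scaleC_one)
  then have "c = 1"
    using x by auto
  then show "\<exists>x. norm x = 1 \<and> p = dyad x"
    using x * scaleC_one by metis
qed

section \<open>Orthonormal families and sums of dyads\<close>

definition orthonormal :: "'i set \<Rightarrow> ('i \<Rightarrow> 'a::complex_hilbert) \<Rightarrow> bool" where
  "orthonormal I x \<longleftrightarrow> (\<forall>i\<in>I. \<forall>j\<in>I. cinner (x i) (x j) = (if i = j then 1 else 0))"

lemma orthonormal_subset: "orthonormal I x \<Longrightarrow> J \<subseteq> I \<Longrightarrow> orthonormal J x"
  by (simp add: orthonormal_def subset_iff)

lemma orthonormal_norm:
  assumes "orthonormal I x" and "i \<in> I"
  shows "norm (x i) = 1"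
proof -
  have "complex_of_real ((norm (x i))\<^sup>2) = of_real 1"
    using assms by (simp only: cinner_self[symmetric]) (simp add: orthonormal_def)
  then have "(norm (x i))\<^sup>2 = 1\<^sup>2"
    by (simp only: of_real_eq_iff) simp
  then show ?thesis
    by (rule power2_eq_imp_eq) simp_all
qed

lemma orthonormal_inj_on: "orthonormal I x \<Longrightarrow> inj_on x I"
  by (rule inj_onI) (metis orthonormal_def zero_neq_one)

lemma orthonormal_independent:
  assumes "orthonormal I x"
  shows "complex_vector.independent (x ` I)"
proof
  assume "complex_vector.dependent (x ` I)"
  then obtain i where i: "i \<in> I" "x i \<in> cspan (x ` I - {x i})"
    by (auto simp: complex_vector.dependent_def)
  \<comment> \<open>The span of the other vectors is orthogonal to \<open>x i\<close>; membership
    would make \<open>x i\<close> orthogonal to itself.\<close>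
  have "cspan (x ` I - {x i}) \<subseteq> {z. cinner z (x i) = 0}"
  proof (rule complex_vector.span_minimal)
    show "x ` I - {x i} \<subseteq> {z. cinner z (x i) = 0}"
      using assms i(1) by (auto simp: orthonormal_def)
    show "complex_vector.subspace {z. cinner z (x i) = 0}"
      by (rule complex_vector.subspaceI) (simp_all add: cinner_simps)
  qed
  then show False
    using i assms by (auto simp: orthonormal_def)
qed

lemma sum_dyad_apply:
  assumes "orthonormal I x" and "finite I" and "j \<in> I"
  shows "bop_apply (\<Sum>i\<in>I. dyad (x i)) (x j) = x j"
proof -
  have "bop_apply (\<Sum>i\<in>I. dyad (x i)) (x j) = (\<Sum>i\<in>I. if i = j then x j else 0)"
    unfolding bop_apply_sum using assms
    by (intro sum.cong) (auto simp: bop_apply_dyad orthonormal_def scaleC_one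
        complex_vector.scale_zero_left)
  then show ?thesis
    using assms by simp
qed

lemma range_sum_dyad:
  assumes "orthonormal I x" and "finite I"
  shows "range (bop_apply (\<Sum>i\<in>I. dyad (x i))) = cspan (x ` I)"
proof
  show "range (bop_apply (\<Sum>i\<in>I. dyad (x i))) \<subseteq> cspan (x ` I)"
    by (auto simp: bop_apply_sum bop_apply_dyad
        intro: complex_vector.span_sum complex_vector.span_scale complex_vector.span_base)
  show "cspan (x ` I) \<subseteq> range (bop_apply (\<Sum>i\<in>I. dyad (x i)))"
    using sum_dyad_apply[OF assms]
    by (intro complex_vector.span_minimal subspace_range_bop_apply) (metis image_subsetI rangeI)
qed

lemma op_rank_sum_dyad:
  assumes "orthonormal I x" and "finite I"
  shows "op_rank (\<Sum>i\<in>I. dyad (x i)) = card I"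
  unfolding op_rank_def range_sum_dyad[OF assms]
  using complex_vector.dim_span_eq_card_independent[OF orthonormal_independent[OF assms(1)]]
    card_image[OF orthonormal_inj_on[OF assms(1)]] by simp

text \<open>A maximal orthonormal family in the range exhausts it, because the range is finite-dimensional.\<close>

lemma projection_eq_sum_dyad:
  assumes e: "projection e" and fin: "finite_rank e"
  obtains x :: "nat \<Rightarrow> 'a::complex_hilbert"
  where "orthonormal {..<op_rank e} x" and "e = (\<Sum>i<op_rank e. dyad (x i))"
proof -
  define P where "P n \<longleftrightarrow> (\<exists>x. orthonormal {..<n} x \<and> (\<forall>i<n. bop_apply e (x i) = x i))" for n :: nat
  obtain B where B: "finite B" "range (bop_apply e) = cspan B"
    using fin by (auto simp: finite_rank_def)
  \<comment> \<open>The family is independent and lies in the span of \<open>B\<close>; this cap on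
    its size is what provides a longest one.\<close>
  have bound: "n \<le> card B" if "P n" for n
  proof -
    obtain x where x: "orthonormal {..<n} x" "\<forall>i<n. bop_apply e (x i) = x i"
      using \<open>P n\<close> by (auto simp: P_def)
    have "x ` {..<n} \<subseteq> cspan B"
      using x(2) B(2) by (metis image_subsetI lessThan_iff rangeI)
    then have "card (x ` {..<n}) \<le> card B"
      using complex_vector.independent_span_bound[OF B(1) orthonormal_independent[OF x(1)]] by blast
    then show ?thesis
      using card_image[OF orthonormal_inj_on[OF x(1)]] by simp
  qed
  have "P 0" by (simp add: P_def orthonormal_def)
  then obtain n where n: "P n" and max: "\<And>m. P m \<Longrightarrow> m \<le> n"
    using Nat.ex_has_greatest_nat[of P 0 "card B"] bound by blast
  obtain x where x: "orthonormal {..<n} x" and ex: "\<And>i. i < n \<Longrightarrow> bop_apply e (x i) = x i"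
    using n by (auto simp: P_def)
  have e_eq: "e = (\<Sum>i<n. dyad (x i))"
  proof (rule bop_eqI, rule ccontr)
    fix z assume ne: "bop_apply e z \<noteq> bop_apply (\<Sum>i<n. dyad (x i)) z"
    \<comment> \<open>The part of \<open>e z\<close> missed by the family. It is fixed by
      \<open>e\<close> and orthogonal to every \<open>x j\<close>, so after normalisation it would
      lengthen the family.\<close>
    define w where "w = bop_apply e z - bop_apply (\<Sum>i<n. dyad (x i)) z"
    obtain c where c: "norm (c *\<^sub>C w) = 1"
      using ne ex_unit_multiple[of w] by (auto simp: w_def)
    have "cinner w (x j) = 0" if "j < n" for j
    proof -
      have "cinner (bop_apply e z) (x j) = cinner z (x j)"
        using cinner_adj_right[of z e "x j"] e ex[OF that] by (simp add: projection_def)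
      moreover have "adj (\<Sum>i<n. dyad (x i)) = (\<Sum>i<n. dyad (x i))"
        by (simp add: adj_sum)
      then have "cinner (bop_apply (\<Sum>i<n. dyad (x i)) z) (x j) = cinner z (x j)"
        using cinner_adj_right[of z "\<Sum>i<n. dyad (x i)" "x j"] sum_dyad_apply[OF x, of j] that
        by simp
      ultimately show ?thesis
        by (simp add: w_def cinner_simps)
    qed
    then have w0: "cinner (c *\<^sub>C w) (x j) = 0" "cinner (x j) (c *\<^sub>C w) = 0" if "j < n" for j
      using that cinner_commute[of "x j" w] by (simp_all add: cinner_simps)
    have "orthonormal {..<Suc n} (x(n := c *\<^sub>C w))"
      using x w0 c by (auto simp: orthonormal_def less_Suc_eq cinner_self[of "c *\<^sub>C w"])
    moreover have "bop_apply e w = w"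
      using e ex by (simp add: w_def bop_apply_arg_simps bop_apply_mult[symmetric] projection_def
          bop_apply_sum bop_apply_dyad bop_apply_arg_sum)
    then have "\<forall>i<Suc n. bop_apply e ((x(n := c *\<^sub>C w)) i) = (x(n := c *\<^sub>C w)) i"
      using ex by (auto simp: less_Suc_eq bop_apply_arg_scaleC)
    ultimately have "P (Suc n)"
      unfolding P_def by blast
    then show False
      using max by fastforce
  qed
  moreover have "op_rank e = n"
    unfolding e_eq using op_rank_sum_dyad[OF x] by simp
  ultimately show ?thesis
    using that x by simp
qed

section \<open>Automorphisms preserve dyads and ranks\<close>

lemma star_automorphism_dyad:
  assumes f: "star_automorphism f" and x: "norm x = 1"
  shows "\<exists>y. norm y = 1 \<and> f (dyad x) = dyad y"
proof -
  have p: "projection (dyad x)" "dyad x \<noteq> 0" "\<And>a. \<exists>c. dyad x * a * dyad x = c *\<^sub>C dyad x"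
    using rank_one_projection_iff[of "dyad x"] x by blast+
  have f0: "f 0 = 0"
    using f by (metis add.right_neutral add_left_cancel star_automorphism_def)
  have inj: "inj f" and surj: "surj f"
    using f by (auto simp: star_automorphism_def bij_def)
  have "projection (f (dyad x))"
    using p(1) f by (metis projection_def star_automorphism_def)
  moreover have "f (dyad x) \<noteq> 0"
    using p(2) f0 inj by (metis injD)
  \<comment> \<open>Minimality quantifies over all operators \<open>a\<close>, so surjectivity is
    used to write \<open>a\<close> as an image.\<close>
  moreover have "\<exists>c. f (dyad x) * a * f (dyad x) = c *\<^sub>C f (dyad x)" for a
  proof -
    obtain b where b: "a = f b" using surj by blast
    obtain c where "dyad x * b * dyad x = c *\<^sub>C dyad x" using p(3) by blast
    then have "f (dyad x) * f b * f (dyad x) = c *\<^sub>C f (dyad x)"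
      using f by (metis star_automorphism_def)
    then show ?thesis using b by blast
  qed
  ultimately show ?thesis
    using rank_one_projection_iff[of "f (dyad x)"] by auto
qed

lemma star_automorphism_sum:
  assumes "star_automorphism f"
  shows "f (\<Sum>i\<in>I. g i) = (\<Sum>i\<in>I. f (g i))"
proof -
  have "f 0 = 0" "\<And>a b. f (a + b) = f a + f b"
    using assms by (metis add.right_neutral add_left_cancel star_automorphism_def)+
  then show ?thesis
    by (induction I rule: infinite_finite_induct) simp_all
qed

text \<open>Split \<open>e\<close> into dyads of an orthonormal family. Their images are dyads of
  unit vectors again, and these stay pairwise orthogonal because products of the original dyads
  vanish.\<close>

lemma star_automorphism_op_rank:
  assumes f: "star_automorphism f" and e: "projection e" "op_rank e > 0"
  shows "op_rank (f e) = op_rank e"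
proof -
  obtain x where x: "orthonormal {..<op_rank e} x" and ex: "e = (\<Sum>i<op_rank e. dyad (x i))"
    using projection_eq_sum_dyad[OF e(1) finite_rank_if_op_rank_pos[OF e(2)]] .
  have "\<exists>y. norm y = 1 \<and> f (dyad (x i)) = dyad y" if "i < op_rank e" for i
    using star_automorphism_dyad[OF f orthonormal_norm[OF x]] that by simp
  then obtain y where y: "\<And>i. i < op_rank e \<Longrightarrow> norm (y i) = 1"
    and fy: "\<And>i. i < op_rank e \<Longrightarrow> f (dyad (x i)) = dyad (y i)"
    by metis
  have f0: "f 0 = 0" and fm: "\<And>a b. f (a * b) = f a * f b"
    using f by (metis add.right_neutral add_left_cancel star_automorphism_def)+
  have "cinner (y i) (y j) = 0" if "i < op_rank e" "j < op_rank e" "i \<noteq> j" for i j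
  proof -
    have "dyad (x j) * dyad (x i) = 0"
      using x that by (intro dyad_mult_dyad) (auto simp: orthonormal_def)
    then have "dyad (y j) * dyad (y i) = 0"
      using fm f0 fy that by metis
    then have "bop_apply (dyad (y j) * dyad (y i)) (y i) = 0"
      by (simp add: bop_apply_zero)
    then show ?thesis
      using y[OF that(1)] y[OF that(2)]
      by (auto simp: bop_apply_mult bop_apply_dyad cinner_self scaleC_one)
  qed
  then have "orthonormal {..<op_rank e} y"
    using y by (auto simp: orthonormal_def cinner_self)
  moreover have "f e = (\<Sum>i<op_rank e. dyad (y i))"
    using arg_cong[OF ex, of f] fy by (simp add: star_automorphism_sum[OF f])
  ultimately show ?thesis
    using op_rank_sum_dyad[of "{..<op_rank e}" y] by simp
qed

section \<open>The identity component of the automorphism group\<close>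

definition unitary :: "'a::complex_hilbert bop \<Rightarrow> bool" where
  "unitary u \<longleftrightarrow> adj u * u = 1 \<and> u * adj u = 1"

lemma unitary_one [simp]: "unitary 1"
  by (simp add: unitary_def)

lemma unitary_mult:
  assumes "unitary u" and "unitary v"
  shows "unitary (u * v)"
proof -
  have "adj v * (adj u * u) * v = 1" "u * (v * adj v) * adj u = 1"
    using assms by (simp_all add: unitary_def)
  then show ?thesis
    by (simp add: unitary_def adj_mult mult.assoc)
qed

lemma cinner_unitary: "unitary u \<Longrightarrow> cinner (bop_apply u x) (bop_apply u y) = cinner x y"
  by (simp add: cinner_adj_right[symmetric] bop_apply_mult[symmetric] unitary_def bop_apply_one)

text \<open>Conjugation \<open>a \<mapsto> u * a * adj u\<close>, assembled from bounded
  multiplication maps so that its continuous dependence on the factors is immediate.\<close>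

definition Ad :: "'a::complex_hilbert bop \<Rightarrow> 'a bop \<Rightarrow>\<^sub>L 'a bop" where
  "Ad u = blinfun_mult_left (adj u) o\<^sub>L blinfun_mult_right u"

lemma Ad_apply: "blinfun_apply (Ad u) a = u * a * adj u"
  by (simp add: Ad_def)

lemma Ad_one: "Ad 1 = id_blinfun"
  by (rule blinfun_eqI) (simp add: Ad_apply)

lemma Ad_mult: "Ad (u * v) = Ad u o\<^sub>L Ad v"
  by (rule blinfun_eqI) (simp add: Ad_apply adj_mult mult.assoc)

lemma star_automorphism_Ad:
  assumes "unitary u"
  shows "star_automorphism (blinfun_apply (Ad u))"
proof -
  have *: "adj u * u = 1" "u * adj u = 1"
    using assms by (simp_all add: unitary_def)
  have cancel: "adj u * (u * a) = a" "u * (adj u * a) = a" for a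
    using * by (simp_all add: mult.assoc[symmetric])
  have "blinfun_apply (Ad u) = (\<lambda>a. u * a * adj u)"
    by (simp add: fun_eq_iff Ad_apply)
  moreover have "bij (\<lambda>a. u * a * adj u)"
    by (rule o_bij[where g = "\<lambda>a. adj u * a * u"]) (simp_all add: fun_eq_iff mult.assoc cancel *)
  ultimately have "bij (blinfun_apply (Ad u))"
    by simp
  then show ?thesis
    by (simp add: star_automorphism_def Ad_apply adj_mult mult_scaleC mult.assoc cancel
        distrib_left distrib_right)
qed

lemma star_automorphism_compose:
  "star_automorphism f \<Longrightarrow> star_automorphism g \<Longrightarrow> star_automorphism (f \<circ> g)"
  using bij_comp[of g f] by (simp add: star_automorphism_def)

section \<open>The identity component and its closure under composition\<close>

lemma id_in_Aut: "id_blinfun \<in> Aut"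
  using bij_id by (simp add: Aut_def star_automorphism_def id_def)

lemma id_in_Aut0: "id_blinfun \<in> Aut0"
  by (simp add: Aut0_def id_in_Aut)

lemma Aut0_subset_Aut: "Aut0 \<subseteq> Aut"
  by (simp add: Aut0_def connected_component_subset)

lemma connected_Aut0: "connected Aut0"
  by (simp add: Aut0_def)

lemma Aut0_star_automorphism: "\<Phi> \<in> Aut0 \<Longrightarrow> star_automorphism (blinfun_apply \<Phi>)"
  using Aut0_subset_Aut by (auto simp: Aut_def)

text \<open>A component absorbs every connected subset that meets it. The point
  \<open>\<Psi>\<close> is the meeting point.\<close>

lemma Aut0I:
  assumes "connected T" and "T \<subseteq> Aut" and "\<Psi> \<in> T" and "\<Psi> \<in> Aut0" and "\<Phi> \<in> T"
  shows "\<Phi> \<in> Aut0"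
proof -
  have "T \<subseteq> connected_component_set Aut \<Psi>"
    using assms by (intro connected_component_maximal)
  also have "\<dots> = Aut0"
    using assms(4) unfolding Aut0_def by (rule connected_component_eq)
  finally show ?thesis
    using assms(5) by blast
qed

lemma Aut0_compose:
  assumes "\<Phi> \<in> Aut0" and "\<Psi> \<in> Aut0"
  shows "\<Phi> o\<^sub>L \<Psi> \<in> Aut0"
proof (rule Aut0I)
  have "continuous_on Aut0 (\<lambda>X. \<Phi> o\<^sub>L X)"
    by (intro continuous_intros)
  then show "connected ((\<lambda>X. \<Phi> o\<^sub>L X) ` Aut0)"
    using connected_Aut0 by (rule connected_continuous_image)
  show "(\<lambda>X. \<Phi> o\<^sub>L X) ` Aut0 \<subseteq> Aut"
    using star_automorphism_compose[OF Aut0_star_automorphism[OF assms(1)] Aut0_star_automorphism]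
    by (auto simp: Aut_def blinfun_compose.rep_eq)
  \<comment> \<open>The left translate of the component meets it in \<open>\<Phi>\<close>, the image
    of the identity.\<close>
  show "\<Phi> \<in> (\<lambda>X. \<Phi> o\<^sub>L X) ` Aut0"
    using id_in_Aut0 by (rule rev_image_eqI) (auto intro: blinfun_eqI)
qed (use assms in auto)

text \<open>For a unit vector \<open>v\<close> this multiplies \<open>v\<close> by \<open>c\<close>
  and fixes the orthogonal complement of \<open>v\<close>.\<close>

definition cplx_reflection :: "complex \<Rightarrow> 'a::complex_hilbert \<Rightarrow> 'a bop" where
  "cplx_reflection c v = 1 + (c - 1) *\<^sub>C dyad v"

lemma cplx_reflection_apply:
  "bop_apply (cplx_reflection c v) x = x + ((c - 1) * cinner x v) *\<^sub>C v"
  by (simp add: cplx_reflection_def bop_apply_simps bop_apply_one bop_apply_dyad scaleC_scaleC)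

lemma adj_cplx_reflection: "adj (cplx_reflection c v) = cplx_reflection (cnj c) v"
  by (simp add: cplx_reflection_def adj_add adj_scaleC)

lemma cplx_reflection_one: "cplx_reflection 1 v = 1"
  by (simp add: cplx_reflection_def complex_vector.scale_zero_left)

text \<open>Multiplicativity in the parameter reduces unitarity to
  \<open>c * cnj c = 1\<close>.\<close>

lemma cplx_reflection_mult:
  assumes "norm v = 1"
  shows "cplx_reflection c v * cplx_reflection d v = cplx_reflection (c * d) v"
proof -
  have "cplx_reflection c v * cplx_reflection d v =
      1 + ((d - 1) *\<^sub>C dyad v + (c - 1) *\<^sub>C dyad v + ((c - 1) * (d - 1)) *\<^sub>C dyad v)"
    unfolding cplx_reflection_def
    by (simp add: distrib_left distrib_right mult_scaleC scaleC_scaleC scaleC_add_right dyad_idem[OF assms]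
        add.assoc mult.commute)
  also have "\<dots> = 1 + ((d - 1) + (c - 1) + (c - 1) * (d - 1)) *\<^sub>C dyad v"
    by (simp only: scaleC_add_left)
  also have "(d - 1) + (c - 1) + (c - 1) * (d - 1) = c * d - 1"
    by (simp add: algebra_simps)
  finally show ?thesis
    by (simp add: cplx_reflection_def)
qed

lemma unitary_cplx_reflection:
  assumes "norm v = 1" and "cmod c = 1"
  shows "unitary (cplx_reflection c v)"
proof -
  have "c * cnj c = 1"
    using complex_norm_square[of c] assms(2) by simp
  then show ?thesis
    by (simp add: unitary_def adj_cplx_reflection cplx_reflection_mult[OF assms(1)]
        cplx_reflection_one mult.commute)
qed

lemma continuous_on_scaleC [continuous_intros]:
  fixes a :: "'a::complex_hilbert bop"
  assumes "continuous_on S f"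
  shows "continuous_on S (\<lambda>t. f t *\<^sub>C a)"
proof -
  \<comment> \<open>Real and imaginary parts reduce complex scaling to two real scalings.\<close>
  have "f t *\<^sub>C a = Re (f t) *\<^sub>R a + Im (f t) *\<^sub>R (\<i> *\<^sub>C a)" for t
    by (simp add: scaleR_scaleC scaleC_scaleC scaleC_add_left[symmetric] complex_eq[symmetric]
        mult.commute)
  then show ?thesis
    using assms by (auto intro!: continuous_intros)
qed

lemma Ad_cplx_reflection_in_Aut0:
  assumes "norm v = 1" and "cmod c = 1"
  shows "Ad (cplx_reflection c v) \<in> Aut0"
proof (rule Aut0I)
  \<comment> \<open>The path along the unit circle is at the identity for \<open>t = 0\<close> and
    at the given reflection for \<open>t = Arg c\<close>.\<close>
  let ?f = "\<lambda>t::real. Ad (cplx_reflection (cis t) v)"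
  have "continuous_on UNIV ?f"
    unfolding Ad_def adj_cplx_reflection unfolding cplx_reflection_def
    by (intro continuous_intros bounded_linear.continuous_on[OF bounded_linear_blinfun_mult_left]
        bounded_linear.continuous_on[OF bounded_linear_blinfun_mult_right])
  then show "connected (range ?f)"
    by (rule connected_continuous_image) simp
  show "range ?f \<subseteq> Aut"
    using assms(1) by (auto simp: Aut_def intro!: star_automorphism_Ad unitary_cplx_reflection)
  have "?f 0 = id_blinfun"
    by (simp add: cplx_reflection_one Ad_one)
  then show "id_blinfun \<in> range ?f"
    by (metis rangeI)
  have "c \<noteq> 0"
    using assms(2) by auto
  then have "c = cis (Arg c)"
    using assms(2) cis_Arg[of c] by (simp add: sgn_eq)
  then show "Ad (cplx_reflection c v) \<in> range ?f"
    by (metis rangeI)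
qed (rule id_in_Aut0)

text \<open>A complex Householder reflection with mirror normal \<open>v \<propto> x - y\<close>. Its eigenvalue \<open>c\<close> on \<open>v\<close> solves
  \<open>(c - 1) \<langle>x, x - y\<rangle> = - \<parallel>x - y\<parallel>\<^sup>2\<close>, which has modulus one since the right-hand side is
  \<open>- 2 Re \<langle>x, x - y\<rangle>\<close>.\<close>

lemma ex_unitary_transporting_unit_vector:
  fixes x y :: "'a::complex_hilbert"
  assumes "norm x = 1" and "norm y = 1"
  shows "\<exists>u. unitary u \<and> Ad u \<in> Aut0 \<and> bop_apply u x = y \<and>
    (\<forall>z. cinner z x = 0 \<longrightarrow> cinner z y = 0 \<longrightarrow> bop_apply u z = z)"
proof (cases "x = y")
  case True
  then show ?thesis
    by (intro exI[of _ 1]) (simp add: Ad_one id_in_Aut0 bop_apply_one)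
next
  case False
  define N where "N = norm (x - y)"
  \<comment> \<open>\<open>w\<close> is \<langle>x, x - y\<rangle>. Since the square of
    \<open>N\<close> is \<open>w + cnj w\<close>, the equation for the eigenvalue is solved by
    \<open>c = - (cnj w / w)\<close>.\<close>
  define w where "w = 1 - cinner x y"
  define c where "c = - (cnj w / w)"
  define v where "v = (1 / N) *\<^sub>R (x - y)"
  have N: "N > 0" using False by (simp add: N_def)
  have wc: "complex_of_real (N\<^sup>2) = w + cnj w"
  proof -
    have "cinner x x = 1" "cinner y y = 1"
      using assms by (simp_all add: cinner_self)
    moreover have "complex_of_real (N\<^sup>2) = cinner (x - y) (x - y)"
      by (simp add: N_def cinner_self)
    ultimately show ?thesis
      by (simp add: w_def cinner_simps cinner_commute[of y x])
  qed
  have w: "w \<noteq> 0" using wc N by auto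
  have c: "cmod c = 1" using w by (simp add: c_def norm_divide)
  have v: "norm v = 1" using N by (simp add: v_def N_def)
  have xv: "cinner x v = w / N"
    using assms by (simp add: v_def w_def cinner_simps cinner_self)
  have "(c - 1) * w = - complex_of_real (N\<^sup>2)"
    using w wc by (simp add: c_def algebra_simps)
  then have "(c - 1) * cinner x v = - complex_of_real N"
    using N by (simp add: xv power2_eq_square)
  then have "bop_apply (cplx_reflection c v) x = x + (- complex_of_real N) *\<^sub>C v"
    by (simp only: cplx_reflection_apply)
  also have "\<dots> = x - N *\<^sub>R v"
    by (simp add: scaleR_scaleC complex_vector.scale_minus_left)
  also have "\<dots> = y"
    using N by (simp add: v_def)
  finally have "bop_apply (cplx_reflection c v) x = y" .
  moreover have "bop_apply (cplx_reflection c v) z = z" if "cinner z x = 0" "cinner z y = 0" for z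
    using that by (simp add: cplx_reflection_apply v_def cinner_simps complex_vector.scale_zero_left)
  ultimately show ?thesis
    using unitary_cplx_reflection[OF v c] Ad_cplx_reflection_in_Aut0[OF v c] by blast
qed

text \<open>Induction on the family: the new factor moves \<open>u (x j)\<close> to
  \<open>y j\<close> and leaves the vectors \<open>y i\<close> already reached in place, as these
  are orthogonal to both.\<close>

lemma ex_unitary_transporting_orthonormal:
  fixes x y :: "'i \<Rightarrow> 'a::complex_hilbert"
  assumes "finite I" and "orthonormal I x" and "orthonormal I y"
  shows "\<exists>u. unitary u \<and> Ad u \<in> Aut0 \<and> (\<forall>i\<in>I. bop_apply u (x i) = y i)"
  using assms
proof (induction I rule: finite_induct)
  case empty
  show ?case
    by (intro exI[of _ 1]) (simp add: Ad_one id_in_Aut0)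
next
  case (insert j I)
  obtain u where u: "unitary u" "Ad u \<in> Aut0" "\<forall>i\<in>I. bop_apply u (x i) = y i"
    using insert.IH insert.prems orthonormal_subset[OF _ subset_insertI] by metis
  have ux: "cinner (bop_apply u (x i)) (bop_apply u (x j)) = cinner (x i) (x j)" for i
    by (rule cinner_unitary[OF u(1)])
  have "norm (bop_apply u (x j)) = 1"
    using ux[of j] orthonormal_norm[OF insert.prems(1), of j] by (simp add: norm_eq_sqrt_cinner)
  moreover have "norm (y j) = 1"
    using orthonormal_norm[OF insert.prems(2)] by simp
  ultimately obtain v where v: "unitary v" "Ad v \<in> Aut0" "bop_apply v (bop_apply u (x j)) = y j"
    and vz: "\<And>z. cinner z (bop_apply u (x j)) = 0 \<Longrightarrow> cinner z (y j) = 0 \<Longrightarrow> bop_apply v z = z"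
    using ex_unitary_transporting_unit_vector by blast
  have "bop_apply v (bop_apply u (x i)) = y i" if "i \<in> I" for i
  proof -
    have "cinner (y i) (bop_apply u (x j)) = cinner (x i) (x j)"
      using ux[of i] u(3) that by simp
    moreover have "cinner (x i) (x j) = 0" "cinner (y i) (y j) = 0"
      using insert.prems insert.hyps that by (auto simp: orthonormal_def)
    ultimately show ?thesis
      using vz u(3) that by simp
  qed
  then show ?case
    using u v by (intro exI[of _ "v * u"]) (simp add: unitary_mult Ad_mult Aut0_compose bop_apply_mult)
qed

section \<open>Polynomial calculus and spectral decomposition\<close>

text \<open>Padding with zero coefficients lets polynomials of different degrees be summed over one
  range.\<close>

lemma poly_op_eq_sum:
  assumes "degree p \<le> n"
  shows "poly_op p a = (\<Sum>i\<le>n. coeff p i *\<^sub>C a ^ i)"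
  unfolding poly_op_def using assms
  by (intro sum.mono_neutral_left) (auto simp: coeff_eq_0 complex_vector.scale_zero_left)

lemma poly_op_0 [simp]: "poly_op 0 a = 0"
  by (simp add: poly_op_def complex_vector.scale_zero_left)

text \<open>The Horner recursion, which makes induction over polynomials available.\<close>

lemma poly_op_pCons: "poly_op (pCons c p) a = c *\<^sub>C 1 + a * poly_op p a"
proof -
  have "poly_op (pCons c p) a = (\<Sum>i\<le>Suc (degree p). coeff (pCons c p) i *\<^sub>C a ^ i)"
    by (rule poly_op_eq_sum) (rule degree_pCons_le)
  also have "\<dots> = c *\<^sub>C 1 + (\<Sum>i\<le>degree p. coeff p i *\<^sub>C (a * a ^ i))"
    by (subst sum.atMost_Suc_shift) simp
  also have "(\<Sum>i\<le>degree p. coeff p i *\<^sub>C (a * a ^ i)) = a * poly_op p a"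
    by (simp add: poly_op_def sum_distrib_left mult_scaleC)
  finally show ?thesis .
qed

lemma poly_op_X: "poly_op [:0, 1:] a = a"
  by (simp add: poly_op_pCons complex_vector.scale_zero_left scaleC_one)

lemma poly_op_1 [simp]: "poly_op 1 a = 1"
  by (simp add: one_pCons poly_op_pCons scaleC_one)

lemma poly_op_add: "poly_op (p + q) a = poly_op p a + poly_op q a"
proof -
  have "poly_op r a = (\<Sum>i\<le>max (degree p) (degree q). coeff r i *\<^sub>C a ^ i)"
    if "degree r \<le> max (degree p) (degree q)" for r
    by (rule poly_op_eq_sum[OF that])
  then show ?thesis
    by (simp add: degree_add_le_max scaleC_add_left sum.distrib)
qed

lemma poly_op_smult: "poly_op (smult c p) a = c *\<^sub>C poly_op p a"
  by (simp add: poly_op_eq_sum[OF degree_smult_le] poly_op_def scaleC_scaleC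
      complex_vector.scale_sum_right)

lemma poly_op_diff: "poly_op (p - q) a = poly_op p a - poly_op q a"
  using poly_op_add[of "p - q" q a] by (simp add: algebra_simps)

lemma poly_op_sum: "poly_op (\<Sum>i\<in>I. p i) a = (\<Sum>i\<in>I. poly_op (p i) a)"
  by (induction I rule: infinite_finite_induct) (simp_all add: poly_op_add)

lemma poly_op_mult: "poly_op (p * q) a = poly_op p a * poly_op q a"
  by (induction p)
    (simp_all add: poly_op_add poly_op_smult poly_op_pCons distrib_right mult_scaleC mult.assoc
      complex_vector.scale_zero_left)

lemma poly_op_power: "poly_op (p ^ n) a = poly_op p a ^ n"
  by (induction n) (simp_all add: poly_op_mult)

lemma poly_op_commute:
  assumes "b * a = a * b"
  shows "b * poly_op p a = poly_op p a * b"
proof (induction p)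
  case (pCons c p)
  have "b * (a * poly_op p a) = a * poly_op p a * b"
    by (metis assms mult.assoc pCons.IH)
  then show ?case
    by (simp add: poly_op_pCons distrib_left distrib_right mult_scaleC)
qed simp

section \<open>Kernels, nilpotents and idempotents among normal operators\<close>

lemma normal_poly_op:
  assumes "normal_op a"
  shows "normal_op (poly_op p a)"
proof -
  have "adj a * poly_op p a = poly_op p a * adj a"
    using assms by (intro poly_op_commute) (simp add: normal_op_def)
  \<comment> \<open>Taking adjoints turns the first commutation into one of
    \<open>adj (poly_op p a)\<close> with \<open>a\<close>, and \<open>poly_op_commute\<close> then
    extends it to \<open>poly_op p a\<close>.\<close>
  then have "adj (adj a * poly_op p a) = adj (poly_op p a * adj a)"
    by simp
  then have "adj (poly_op p a) * a = a * adj (poly_op p a)"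
    by (simp add: adj_mult)
  then show ?thesis
    unfolding normal_op_def by (rule poly_op_commute)
qed

text \<open>Normality makes the norms of \<open>adj b\<close> and \<open>b\<close> agree at every
  vector, so the kernels are comparable.\<close>

lemma normal_op_adj_apply_zero:
  assumes "normal_op b" and "bop_apply b x = 0"
  shows "bop_apply (adj b) x = 0"
proof -
  have "cinner (bop_apply (adj b) x) (bop_apply (adj b) x) = cinner (bop_apply (b * adj b) x) x"
    by (simp add: cinner_adj_right bop_apply_mult)
  also have "b * adj b = adj b * b"
    using assms(1) by (simp add: normal_op_def)
  also have "cinner (bop_apply (adj b * b) x) x = 0"
    by (simp add: bop_apply_mult assms(2))
  finally show ?thesis
    by (simp add: cinner_eq_zero_iff)
qed

text \<open>A vector in the range of \<open>b\<close> that \<open>b\<close> kills is also killed by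
  \<open>adj b\<close>, hence orthogonal to the range of \<open>b\<close> and so to itself.\<close>

lemma normal_op_mult_cancel:
  assumes "normal_op b" and "b * (b * c) = 0"
  shows "b * c = 0"
proof (rule bop_eqI)
  fix x
  let ?y = "bop_apply (b * c) x"
  have "bop_apply b ?y = 0"
    by (simp only: bop_apply_mult[symmetric] assms(2) bop_apply_zero)
  then have "bop_apply (adj b) ?y = 0"
    by (rule normal_op_adj_apply_zero[OF assms(1)])
  then have "cinner ?y ?y = 0"
    using cinner_adj_right[of "bop_apply c x" b ?y] by (simp add: bop_apply_mult)
  then show "?y = bop_apply 0 x"
    by (simp add: cinner_eq_zero_iff bop_apply_zero)
qed

lemma normal_op_nilpotent:
  assumes "normal_op b" and "b ^ n = 0"
  shows "b = 0"
proof -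
  \<comment> \<open>The extra factor \<open>b\<close> makes the base case of the induction,
    \<open>b * 1 = 0\<close>, the claim itself.\<close>
  have "b * b ^ n = 0"
    using assms(2) by simp
  then show ?thesis
  proof (induction n)
    case (Suc n)
    then show ?case
      using normal_op_mult_cancel[OF assms(1), of "b ^ n"] by simp
  qed simp
qed

text \<open>The vector \<open>x - e x\<close> lies in the kernel of \<open>e\<close>, hence in that
  of \<open>adj e\<close>. This gives \<open>adj e = adj e * e\<close>, whose right-hand side is
  self-adjoint.\<close>

lemma projection_if_normal_idempotent:
  assumes "normal_op e" and "e * e = e"
  shows "projection e"
proof -
  have "bop_apply (adj e) (x - bop_apply e x) = 0" for x
    using assms(2)
    by (intro normal_op_adj_apply_zero[OF assms(1)])
      (simp add: bop_apply_arg_diff bop_apply_mult[symmetric])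
  then have *: "adj e = adj e * e"
    by (intro bop_eqI) (simp add: bop_apply_arg_diff bop_apply_mult)
  then have "adj (adj e) = adj (adj e * e)"
    by simp
  then have "e = adj e * e"
    by (simp add: adj_mult)
  with * assms(2) show ?thesis
    by (simp add: projection_def)
qed

text \<open>By the Nullstellensatz some power of \<open>q - r\<close> is a multiple of \<open>p\<close>, and normal nilpotents vanish.\<close>

lemma normal_poly_op_cong:
  assumes a: "normal_op a" and p: "p \<noteq> 0" "poly_op p a = 0"
    and eq: "\<And>z. poly p z = 0 \<Longrightarrow> poly q z = poly r z"
  shows "poly_op q a = poly_op r a"
proof -
  have "\<forall>z. poly p z = 0 \<longrightarrow> poly (q - r) z = 0"
    using eq by simp
  then obtain s where "(q - r) ^ degree p = p * s"
    using nullstellensatz_univariate p(1) unfolding dvd_def by blast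
  then have "poly_op (q - r) a ^ degree p = 0"
    using p(2) by (simp add: poly_op_power[symmetric] poly_op_mult)
  then have "poly_op (q - r) a = 0"
    by (rule normal_op_nilpotent[OF normal_poly_op[OF a]])
  then show ?thesis
    by (simp add: poly_op_diff)
qed

lemma ex_Lagrange_poly:
  fixes S :: "'b::field set"
  assumes "finite S" and "s \<in> S"
  shows "\<exists>L. \<forall>t\<in>S. poly L t = (if t = s then 1 else 0)"
proof -
  define L where "L = (\<Prod>t\<in>S - {s}. [:- t / (s - t), 1 / (s - t):])"
  have L: "poly L z = (\<Prod>t\<in>S - {s}. (z - t) / (s - t))" for z
    by (simp add: L_def poly_prod diff_divide_distrib)
  have "poly L s = 1"
    unfolding L by (intro prod.neutral) auto
  moreover have "poly L t = 0" if "t \<in> S" "t \<noteq> s" for t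
    unfolding L using assms that by (intro prod_zero) auto
  ultimately show ?thesis by (intro exI[of _ L]) auto
qed

lemma projection_op_rank_pos:
  assumes "projection e" and "finite_rank e" and "e \<noteq> 0"
  shows "op_rank e > 0"
proof (rule ccontr)
  assume "\<not> op_rank e > 0"
  then have "e = 0"
    using projection_eq_sum_dyad[OF assms(1,2)] by (metis gr0I lessThan_0 sum.empty)
  with assms(3) show False by simp
qed

section \<open>Normal algebraic elements of finite rank are exactly the elements of the sets
  \<open>M\<close>\<close>

lemma MI:
  assumes "\<And>k. k < n \<Longrightarrow> projection (e k)" and "\<And>k. k < n \<Longrightarrow> op_rank (e k) = R ! k"
    and "\<And>j k. j < n \<Longrightarrow> k < n \<Longrightarrow> j \<noteq> k \<Longrightarrow> e j * e k = 0"
    and "a = (\<Sum>k<n. \<Lambda> ! k *\<^sub>C e k)"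
  shows "a \<in> M n \<Lambda> R"
  unfolding M_def using assms by blast

lemma ME:
  assumes "a \<in> M n \<Lambda> R"
  obtains e where "\<And>k. k < n \<Longrightarrow> projection (e k)" "\<And>k. k < n \<Longrightarrow> op_rank (e k) = R ! k"
    "\<And>j k. j < n \<Longrightarrow> k < n \<Longrightarrow> j \<noteq> k \<Longrightarrow> e j * e k = 0" "a = (\<Sum>k<n. \<Lambda> ! k *\<^sub>C e k)"
  using assms unfolding M_def by blast

theorem normal_algebraic_finite_rank_in_M:
  fixes a :: "'a::complex_hilbert bop"
  assumes "a \<in> normal_algebraic_finite_rank"
  shows "\<exists>n \<Lambda> R. parameters n \<Lambda> R \<and> a \<in> M n \<Lambda> R"
proof -
  have a: "a \<noteq> 0" "normal_op a" "finite_rank a"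
    using assms by (auto simp: normal_algebraic_finite_rank_def)
  obtain p where p: "p \<noteq> 0" "poly_op p a = 0"
    using assms by (auto simp: normal_algebraic_finite_rank_def algebraic_op_def)
  note cong = normal_poly_op_cong[OF a(2) p]
  define S where "S = {z. poly p z = 0}"
  have S: "finite S" unfolding S_def by (rule poly_roots_finite[OF p(1)])
  \<comment> \<open>On the root set \<open>S\<close> the polynomial \<open>L s\<close> is the
    indicator of \<open>s\<close>. Through \<open>cong\<close>, identities between the operators
    \<open>E s\<close> only need to be checked as values on \<open>S\<close>.\<close>
  obtain L where L: "\<And>s t. s \<in> S \<Longrightarrow> t \<in> S \<Longrightarrow> poly (L s) t = (if t = s then 1 else 0)"
    using ex_Lagrange_poly[OF S] by metis
  define E where "E s = poly_op (L s) a" for s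
  have E_mult: "E s * E t = (if s = t then E s else 0)" if "s \<in> S" "t \<in> S" for s t
  proof -
    have "poly_op (L s * L t) a = poly_op (if s = t then L s else 0) a"
      using L that by (intro cong) (auto simp: S_def)
    then show ?thesis by (auto simp: E_def poly_op_mult split: if_splits)
  qed
  have proj: "projection (E s)" if "s \<in> S" for s
    using E_mult[OF that that] normal_poly_op[OF a(2)]
    by (intro projection_if_normal_idempotent) (simp_all add: E_def)
  \<comment> \<open>The polynomials \<open>X * L s\<close> and \<open>s * L s\<close> agree on
    \<open>S\<close>.\<close>
  have aE: "a * E s = s *\<^sub>C E s" if "s \<in> S" for s
  proof -
    have "poly_op ([:0, 1:] * L s) a = poly_op (smult s (L s)) a"
      using L that by (intro cong) (auto simp: S_def)
    then show ?thesis by (simp only: E_def poly_op_mult poly_op_X poly_op_smult)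
  qed
  \<comment> \<open>For non-zero \<open>s\<close> the range of \<open>E s\<close> lies inside that
    of \<open>a\<close>. The root 0 has to be excluded: its projection may have infinite
    rank.\<close>
  have rank: "finite_rank (E s)" if "s \<in> S" "s \<noteq> 0" for s
  proof -
    have "bop_apply (E s) x = bop_apply a ((1 / s) *\<^sub>C bop_apply (E s) x)" for x
      using arg_cong[OF aE[OF that(1)], of "\<lambda>b. bop_apply b x"] that(2)
      by (simp add: bop_apply_mult bop_apply_arg_scaleC bop_apply_simps scaleC_scaleC scaleC_one)
    then have "range (bop_apply (E s)) \<subseteq> range (bop_apply a)" by (metis image_subsetI rangeI)
    then show ?thesis
      using a(3) finite_rankI by (metis finite_rank_def)
  qed
  \<comment> \<open>Besides 0, this discards the roots of \<open>p\<close> that are not eigenvalues,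
    where \<open>E s\<close> vanishes and would have rank 0.\<close>
  define T where "T = {s \<in> S. s \<noteq> 0 \<and> E s \<noteq> 0}"
  obtain \<Lambda> where \<Lambda>: "set \<Lambda> = T" "distinct \<Lambda>"
    using finite_distinct_list[of T] S by (auto simp: T_def)
  define n where "n = length \<Lambda>"
  have nth: "\<Lambda> ! k \<in> T" if "k < n" for k
    using that \<Lambda>(1) by (auto simp: n_def)
  \<comment> \<open>Lagrange interpolation of the identity polynomial on \<open>S\<close>.\<close>
  have "a = poly_op (\<Sum>s\<in>S. smult s (L s)) a"
  proof -
    have "poly (\<Sum>s\<in>S. smult s (L s)) z = z" if "z \<in> S" for z
    proof -
      have "(\<Sum>s\<in>S. s * poly (L s) z) = (\<Sum>s\<in>S. if s = z then z else 0)"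
        using that L by (intro sum.cong) auto
      then show ?thesis using S that by (simp add: poly_sum)
    qed
    then have "poly_op [:0, 1:] a = poly_op (\<Sum>s\<in>S. smult s (L s)) a"
      by (intro cong) (simp add: S_def)
    then show ?thesis by (simp add: poly_op_X)
  qed
  also have "\<dots> = (\<Sum>s\<in>S. s *\<^sub>C E s)"
    by (simp add: poly_op_sum poly_op_smult E_def)
  also have "\<dots> = (\<Sum>s\<in>T. s *\<^sub>C E s)"
    using S by (intro sum.mono_neutral_right)
      (auto simp: T_def complex_vector.scale_zero_left complex_vector.scale_zero_right)
  also have "\<dots> = (\<Sum>k<n. \<Lambda> ! k *\<^sub>C E (\<Lambda> ! k))"
    by (intro sum.reindex_bij_betw[symmetric] bij_betw_nth) (simp_all add: \<Lambda> n_def)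
  finally have a_eq: "a = (\<Sum>k<n. \<Lambda> ! k *\<^sub>C E (\<Lambda> ! k))" .
  have "a \<in> M n \<Lambda> (map (\<lambda>s. op_rank (E s)) \<Lambda>)"
  proof (rule MI[OF _ _ _ a_eq])
    show "E (\<Lambda> ! j) * E (\<Lambda> ! k) = 0" if "j < n" "k < n" "j \<noteq> k" for j k
      using nth[of j] nth[of k] that \<Lambda>(2) E_mult[of "\<Lambda> ! j" "\<Lambda> ! k"]
      by (auto simp: T_def n_def nth_eq_iff_index_eq)
    show "projection (E (\<Lambda> ! k))" if "k < n" for k
      using nth[OF that] proj by (simp add: T_def)
  qed (simp add: n_def)
  moreover have "n > 0"
    using a(1) a_eq by (cases n) auto
  then have "parameters n \<Lambda> (map (\<lambda>s. op_rank (E s)) \<Lambda>)"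
    using nth \<Lambda>(2) by (auto simp: parameters_def n_def T_def intro!: projection_op_rank_pos proj rank)
  ultimately show ?thesis by blast
qed

lemma orthogonal_projections_combination:
  fixes e :: "nat \<Rightarrow> 'a::complex_hilbert bop"
  assumes "\<And>k. k < n \<Longrightarrow> projection (e k)"
    and "\<And>j k. j < n \<Longrightarrow> k < n \<Longrightarrow> j \<noteq> k \<Longrightarrow> e j * e k = 0" and "k < n"
  shows "(\<Sum>j<n. l j *\<^sub>C e j) * e k = l k *\<^sub>C e k" "e k * (\<Sum>j<n. l j *\<^sub>C e j) = l k *\<^sub>C e k"
proof -
  have "e j * e k = (if j = k then e k else 0)" "e k * e j = (if j = k then e k else 0)"
    if "j < n" for j
    using assms that by (auto simp: projection_def)
  then have "(\<Sum>j<n. l j *\<^sub>C e j) * e k = (\<Sum>j<n. if j = k then l k *\<^sub>C e k else 0)"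
    "e k * (\<Sum>j<n. l j *\<^sub>C e j) = (\<Sum>j<n. if j = k then l k *\<^sub>C e k else 0)"
    unfolding sum_distrib_right sum_distrib_left mult_scaleC
    by (intro sum.cong refl; simp add: complex_vector.scale_zero_right)+
  then show "(\<Sum>j<n. l j *\<^sub>C e j) * e k = l k *\<^sub>C e k" "e k * (\<Sum>j<n. l j *\<^sub>C e j) = l k *\<^sub>C e k"
    using assms(3) by simp_all
qed

theorem M_subset_normal_algebraic_finite_rank:
  assumes par: "parameters n \<Lambda> R" and aM: "a \<in> M n \<Lambda> R"
  shows "a \<in> normal_algebraic_finite_rank"
proof -
  obtain e where e: "\<And>k. k < n \<Longrightarrow> projection (e k)" "\<And>k. k < n \<Longrightarrow> op_rank (e k) = R ! k"
    and orth: "\<And>j k. j < n \<Longrightarrow> k < n \<Longrightarrow> j \<noteq> k \<Longrightarrow> e j * e k = 0"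
    and a: "a = (\<Sum>k<n. \<Lambda> ! k *\<^sub>C e k)"
    using ME[OF aM] by blast
  have ae: "a * e k = \<Lambda> ! k *\<^sub>C e k" if "k < n" for k
    unfolding a by (rule orthogonal_projections_combination(1)[OF e(1) orth that])
  have ea: "e k * a = \<Lambda> ! k *\<^sub>C e k" if "k < n" for k
    unfolding a by (rule orthogonal_projections_combination(2)[OF e(1) orth that])
  have rank: "finite_rank (e k)" if "k < n" for k
    using par e(2)[OF that] that by (intro finite_rank_if_op_rank_pos) (simp add: parameters_def)
  have "a \<noteq> 0"
  proof
    assume "a = 0"
    moreover have n: "0 < n" "\<Lambda> ! 0 \<noteq> 0" "R ! 0 > 0" using par by (auto simp: parameters_def)
    ultimately have "e 0 = 0" using ae[of 0] by simp
    then have "op_rank (e 0) = 0"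
      using op_rank_sum_dyad[of "{}" "\<lambda>_. 0"] by (simp add: orthonormal_def)
    then show False using e(2)[of 0] n by simp
  qed
  moreover have "normal_op a"
  proof -
    have adj_a: "adj a = (\<Sum>k<n. cnj (\<Lambda> ! k) *\<^sub>C e k)"
      using e(1) by (simp add: a adj_sum adj_scaleC projection_def)
    show ?thesis
      unfolding normal_op_def adj_a sum_distrib_left sum_distrib_right
      by (intro sum.cong) (simp_all add: mult_scaleC ae ea)
  qed
  moreover have "algebraic_op a"
  proof -
    \<comment> \<open>\<open>q(a)\<close> kills the range of every \<open>e k\<close>. The further
      factor \<open>X\<close> used below takes care of the rest of the space, because
      \<open>a\<close> is a combination of the \<open>e k\<close>.\<close>
    define q where "q = (\<Prod>s\<in>set \<Lambda>. [:- s, 1:])"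
    have ann: "poly_op p a * e k = poly p (\<Lambda> ! k) *\<^sub>C e k" if "k < n" for p k
    proof (induction p)
      case (pCons c p)
      then show ?case
        by (simp add: poly_op_pCons distrib_right mult_scaleC mult.assoc ae[OF that]
            scaleC_add_left scaleC_scaleC mult.commute)
    qed (simp add: complex_vector.scale_zero_left)
    have "poly q (\<Lambda> ! k) = 0" if "k < n" for k
      using that par unfolding q_def poly_prod parameters_def by (intro prod_zero) auto
    then have "poly_op (q * [:0, 1:]) a = 0"
      unfolding poly_op_mult poly_op_X
      by (subst (2) a) (simp add: sum_distrib_left mult_scaleC ann complex_vector.scale_zero_left
          complex_vector.scale_zero_right)
    moreover have "q * [:0, 1:] \<noteq> 0"
      by (simp add: q_def)
    ultimately show ?thesis
      unfolding algebraic_op_def by blast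
  qed
  moreover have "finite_rank a"
  proof -
    obtain B where B: "\<And>k. k < n \<Longrightarrow> finite (B k) \<and> range (bop_apply (e k)) = cspan (B k)"
      using rank unfolding finite_rank_def by metis
    show ?thesis
    proof (rule finite_rankI)
      show "finite (\<Union>k<n. B k)" using B by simp
      have "bop_apply (e k) x \<in> cspan (\<Union>k<n. B k)" if "k < n" for k x
        using B[OF that] complex_vector.span_mono[of "B k" "\<Union>k<n. B k"] that by blast
      then show "range (bop_apply a) \<subseteq> cspan (\<Union>k<n. B k)"
        by (auto simp: a bop_apply_sum bop_apply_simps
            intro!: complex_vector.span_sum complex_vector.span_scale)
    qed
  qed
  ultimately show ?thesis
    by (simp add: normal_algebraic_finite_rank_def)
qed

section \<open>Eigenspaces and transitivity\<close>

text \<open>Both right-hand sides depend on \<open>a\<close> alone; this is what forces two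
  parametrisations of one element to agree up to order.\<close>

lemma eigenspace_M:
  assumes par: "parameters n \<Lambda> R" and aM: "a \<in> M n \<Lambda> R"
  shows "set \<Lambda> = {s. s \<noteq> 0 \<and> (\<exists>x. x \<noteq> 0 \<and> bop_apply a x = s *\<^sub>C x)}" (is "_ = ?E")
    and "k < n \<Longrightarrow> R ! k = cdim {x. bop_apply a x = \<Lambda> ! k *\<^sub>C x}"
proof -
  obtain e where e: "\<And>k. k < n \<Longrightarrow> projection (e k)" "\<And>k. k < n \<Longrightarrow> op_rank (e k) = R ! k"
    and orth: "\<And>j k. j < n \<Longrightarrow> k < n \<Longrightarrow> j \<noteq> k \<Longrightarrow> e j * e k = 0"
    and a: "a = (\<Sum>k<n. \<Lambda> ! k *\<^sub>C e k)"
    using ME[OF aM] by blast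
  have ae: "a * e k = \<Lambda> ! k *\<^sub>C e k" if "k < n" for k
    unfolding a by (rule orthogonal_projections_combination(1)[OF e(1) orth that])
  have ea: "e k * a = \<Lambda> ! k *\<^sub>C e k" if "k < n" for k
    unfolding a by (rule orthogonal_projections_combination(2)[OF e(1) orth that])
  have len: "length \<Lambda> = n" and dist: "distinct \<Lambda>" and nz: "\<And>k. k < n \<Longrightarrow> \<Lambda> ! k \<noteq> 0"
    and pos: "\<And>k. k < n \<Longrightarrow> R ! k > 0"
    using par by (auto simp: parameters_def)
  \<comment> \<open>Evaluating \<open>e k * a\<close> at an eigenvector in two ways leaves the
    component in the range of \<open>e k\<close> scaled by both \<open>s\<close> and
    \<open>\<Lambda> ! k\<close>.\<close>
  have comp: "bop_apply (e k) x = 0" if "k < n" "bop_apply a x = s *\<^sub>C x" "s \<noteq> \<Lambda> ! k" for k s x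
  proof -
    have "s *\<^sub>C bop_apply (e k) x = bop_apply (e k * a) x"
      by (simp add: bop_apply_mult that(2) bop_apply_arg_scaleC)
    also have "\<dots> = \<Lambda> ! k *\<^sub>C bop_apply (e k) x"
      by (simp add: ea[OF that(1)] bop_apply_simps)
    finally show ?thesis
      using that(3) by (simp add: complex_vector.scale_cancel_right)
  qed
  have ax: "bop_apply a x = (\<Sum>k<n. \<Lambda> ! k *\<^sub>C bop_apply (e k) x)" for x
    by (simp add: a bop_apply_sum bop_apply_simps)
  have range: "range (bop_apply (e k)) = {x. bop_apply a x = \<Lambda> ! k *\<^sub>C x}" if k: "k < n" for k
  proof
    show "range (bop_apply (e k)) \<subseteq> {x. bop_apply a x = \<Lambda> ! k *\<^sub>C x}"
      using ae[OF k] by (auto simp: bop_apply_mult[symmetric] bop_apply_simps)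
    show "{x. bop_apply a x = \<Lambda> ! k *\<^sub>C x} \<subseteq> range (bop_apply (e k))"
    proof safe
      fix x assume x: "bop_apply a x = \<Lambda> ! k *\<^sub>C x"
      have "bop_apply (e j) x = 0" if "j < n" "j \<noteq> k" for j
        using comp[OF that(1) x] dist len k that by (simp add: nth_eq_iff_index_eq)
      then have "bop_apply a x = (\<Sum>j<n. if j = k then \<Lambda> ! k *\<^sub>C bop_apply (e k) x else 0)"
        unfolding ax by (intro sum.cong) (auto simp: complex_vector.scale_zero_right)
      then have "\<Lambda> ! k *\<^sub>C x = \<Lambda> ! k *\<^sub>C bop_apply (e k) x"
        using k x by simp
      then have "x = bop_apply (e k) x"
        using nz[OF k] by (simp add: complex_vector.scale_cancel_left)
      then show "x \<in> range (bop_apply (e k))"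
        by (metis rangeI)
    qed
  qed
  then show R: "R ! k = cdim {x. bop_apply a x = \<Lambda> ! k *\<^sub>C x}" if "k < n" for k
    using e(2)[OF that] that by (simp add: op_rank_def)
  show "set \<Lambda> = ?E"
  proof (intro equalityI subsetI CollectI conjI)
    fix s assume "s \<in> set \<Lambda>"
    then obtain k where k: "k < n" "s = \<Lambda> ! k" using len by (auto simp: in_set_conv_nth)
    then show "s \<noteq> 0" using nz by simp
    \<comment> \<open>Positive dimension rules out the zero space, so an eigenvector exists.\<close>
    have "\<not> {x. bop_apply a x = \<Lambda> ! k *\<^sub>C x} \<subseteq> cspan {}"
      using R[OF k(1)] pos[OF k(1)] complex_vector.dim_le_card[of "{x. bop_apply a x = \<Lambda> ! k *\<^sub>C x}" "{}"]
      by auto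
    then show "\<exists>x. x \<noteq> 0 \<and> bop_apply a x = s *\<^sub>C x"
      using k(2) by auto
  next
    fix s assume "s \<in> ?E"
    then obtain x where s: "s \<noteq> 0" and x: "x \<noteq> 0" "bop_apply a x = s *\<^sub>C x"
      by blast
    show "s \<in> set \<Lambda>"
    proof (rule ccontr)
      assume "s \<notin> set \<Lambda>"
      then have "bop_apply (e k) x = 0" if "k < n" for k
        using comp[OF that x(2)] that len nth_mem by metis
      then have "s *\<^sub>C x = 0"
        using x(2) ax[of x] by (simp add: complex_vector.scale_zero_right)
      then show False using s x(1) by (simp add: complex_vector.scale_eq_0_iff)
    qed
  qed
qed

section \<open>Uniqueness of the parameters up to permutation\<close>

lemma same_up_to_permutation_if_common_element:
  fixes a :: "'a::complex_hilbert bop"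
  assumes par: "parameters n \<Lambda> R" "parameters n' \<Lambda>' R'"
    and a: "a \<in> M n \<Lambda> R" "a \<in> M n' \<Lambda>' R'"
  shows "same_up_to_permutation (n, \<Lambda>, R) (n', \<Lambda>', R')"
proof -
  have dist: "distinct \<Lambda>" "distinct \<Lambda>'" and len: "length \<Lambda> = n" "length R = n"
      "length \<Lambda>' = n'" "length R' = n'"
    using par by (auto simp: parameters_def)
  have set: "set \<Lambda>' = set \<Lambda>"
    unfolding eigenspace_M(1)[OF par(1) a(1)] eigenspace_M(1)[OF par(2) a(2)] ..
  then have n': "n' = n"
    using dist len distinct_card by metis
  \<comment> \<open>Distinct lists with the same elements are equal as multisets, which supplies
    \<open>\<pi>\<close>. The same \<open>\<pi>\<close> carries \<open>R\<close> to
    \<open>R'\<close>, as entries of both are dimensions of matching eigenspaces.\<close>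
  have "mset \<Lambda>' = mset \<Lambda>"
    using set dist by (simp add: set_eq_iff_mset_eq_distinct[symmetric])
  then obtain \<pi> where "\<pi> permutes {..<length \<Lambda>}" and \<pi>': "permute_list \<pi> \<Lambda> = \<Lambda>'"
    by (rule mset_eq_permutation)
  then have \<pi>: "\<pi> permutes {..<n}"
    using len by simp
  have "R' = permute_list \<pi> R"
  proof (rule nth_equalityI)
    fix i assume "i < length R'"
    then have i: "i < n" using len n' by simp
    have \<pi>i: "\<pi> i < n" using permutes_in_image[OF \<pi>, of i] i by simp
    have "R' ! i = cdim {x. bop_apply a x = \<Lambda>' ! i *\<^sub>C x}"
      using eigenspace_M(2)[OF par(2) a(2)] i n' by simp
    also have "\<Lambda>' ! i = \<Lambda> ! \<pi> i"
      using \<pi>'[symmetric] permute_list_nth[of \<pi> \<Lambda> i] \<pi> i len by simp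
    also have "cdim {x. bop_apply a x = \<Lambda> ! \<pi> i *\<^sub>C x} = R ! \<pi> i"
      using eigenspace_M(2)[OF par(1) a(1) \<pi>i] by simp
    also have "\<dots> = permute_list \<pi> R ! i"
      using permute_list_nth[of \<pi> R i] \<pi> i len by simp
    finally show "R' ! i = permute_list \<pi> R ! i" .
  qed (simp add: len n')
  then show ?thesis
    unfolding same_up_to_permutation_def using n' \<pi> \<pi>' by (simp add: exI[of _ \<pi>])
qed

text \<open>Reindexing the projections. Equality follows later by applying this to the inverse
  permutation as well.\<close>

lemma M_subset_permute:
  assumes \<pi>: "\<pi> permutes {..<n}" and len: "length \<Lambda> = n" "length R = n"
  shows "M n \<Lambda> R \<subseteq> M n (permute_list \<pi> \<Lambda>) (permute_list \<pi> R)"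
proof
  fix a assume "a \<in> M n \<Lambda> R"
  then obtain e where e: "\<And>k. k < n \<Longrightarrow> projection (e k)" "\<And>k. k < n \<Longrightarrow> op_rank (e k) = R ! k"
    and orth: "\<And>j k. j < n \<Longrightarrow> k < n \<Longrightarrow> j \<noteq> k \<Longrightarrow> e j * e k = 0"
    and a: "a = (\<Sum>k<n. \<Lambda> ! k *\<^sub>C e k)"
    by (rule ME) blast
  have lt: "\<pi> k < n" if "k < n" for k
    using permutes_in_image[OF \<pi>, of k] that by simp
  have nth: "permute_list \<pi> \<Lambda> ! k = \<Lambda> ! \<pi> k" "permute_list \<pi> R ! k = R ! \<pi> k" if "k < n" for k
    using permute_list_nth[of \<pi> \<Lambda> k] permute_list_nth[of \<pi> R k] \<pi> len that by simp_all
  show "a \<in> M n (permute_list \<pi> \<Lambda>) (permute_list \<pi> R)"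
  proof (rule MI)
    show "projection (e (\<pi> k))" "op_rank (e (\<pi> k)) = permute_list \<pi> R ! k" if "k < n" for k
      using e lt nth that by simp_all
    show "e (\<pi> j) * e (\<pi> k) = 0" if "j < n" "k < n" "j \<noteq> k" for j k
      using orth lt that permutes_inj[OF \<pi>] by (simp add: inj_eq)
    have "a = (\<Sum>k<n. \<Lambda> ! \<pi> k *\<^sub>C e (\<pi> k))"
      unfolding a using sum.permute[OF \<pi>, of "\<lambda>k. \<Lambda> ! k *\<^sub>C e k"] by (simp add: comp_def)
    then show "a = (\<Sum>k<n. permute_list \<pi> \<Lambda> ! k *\<^sub>C e (\<pi> k))"
      using nth by simp
  qed
qed

lemma M_eq_if_same_up_to_permutation:
  assumes par: "parameters n \<Lambda> R" and same: "same_up_to_permutation (n, \<Lambda>, R) (n', \<Lambda>', R')"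
  shows "M n \<Lambda> R = M n' \<Lambda>' R'"
proof -
  obtain \<pi> where \<pi>: "\<pi> permutes {..<n}" and eq: "n' = n" "\<Lambda>' = permute_list \<pi> \<Lambda>" "R' = permute_list \<pi> R"
    using same by (auto simp: same_up_to_permutation_def)
  have len: "length \<Lambda> = n" "length R = n" using par by (auto simp: parameters_def)
  have inv: "inv \<pi> permutes {..<n}" by (rule permutes_inv[OF \<pi>])
  have "permute_list (inv \<pi>) (permute_list \<pi> xs) = xs" if "length xs = n" for xs :: "'b list"
    using permute_list_compose[of "inv \<pi>" xs \<pi>] inv that permutes_inv_o(1)[OF \<pi>] by simp
  from this[OF len(1)] this[OF len(2)] have "M n' \<Lambda>' R' \<subseteq> M n \<Lambda> R"
    using M_subset_permute[OF inv, of \<Lambda>' R'] eq len by simp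
  moreover have "M n \<Lambda> R \<subseteq> M n' \<Lambda>' R'"
    unfolding eq by (rule M_subset_permute[OF \<pi> len])
  ultimately show ?thesis by blast
qed

text \<open>Being a projection and being orthogonal are algebraic conditions, and positive ranks
  survive by \<open>star_automorphism_op_rank\<close>; so the images of the \<open>e k\<close>
  represent \<open>f a\<close>.\<close>

lemma star_automorphism_M:
  assumes par: "parameters n \<Lambda> R" and f: "star_automorphism f" and aM: "a \<in> M n \<Lambda> R"
  shows "f a \<in> M n \<Lambda> R"
proof -
  obtain e where e: "\<And>k. k < n \<Longrightarrow> projection (e k)" "\<And>k. k < n \<Longrightarrow> op_rank (e k) = R ! k"
    and orth: "\<And>j k. j < n \<Longrightarrow> k < n \<Longrightarrow> j \<noteq> k \<Longrightarrow> e j * e k = 0"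
    and a: "a = (\<Sum>k<n. \<Lambda> ! k *\<^sub>C e k)"
    using ME[OF aM] by blast
  have f0: "f 0 = 0" and fm: "\<And>a b. f (a * b) = f a * f b" and fs: "\<And>c a. f (c *\<^sub>C a) = c *\<^sub>C f a"
    and fadj: "\<And>a. f (adj a) = adj (f a)"
    using f by (metis add.right_neutral add_left_cancel star_automorphism_def)+
  show ?thesis
  proof (rule MI)
    show "projection (f (e k))" if "k < n" for k
      using e(1)[OF that] fm fadj by (metis projection_def)
    show "op_rank (f (e k)) = R ! k" if "k < n" for k
      using star_automorphism_op_rank[OF f e(1)[OF that]] e(2)[OF that] par that
      by (simp add: parameters_def)
    show "f (e j) * f (e k) = 0" if "j < n" "k < n" "j \<noteq> k" for j k
      using orth[OF that] fm f0 by metis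
    show "f a = (\<Sum>k<n. \<Lambda> ! k *\<^sub>C f (e k))"
      by (simp add: a star_automorphism_sum[OF f] fs)
  qed
qed

text \<open>Merges orthonormal bases of the ranges of all \<open>e k\<close> into one family. Its
  index set depends only on \<open>n\<close> and \<open>R\<close>, so any two elements of the same
  \<open>M n \<Lambda> R\<close> have families that can be matched index by index.\<close>

lemma M_orthonormal:
  assumes par: "parameters n \<Lambda> R" and aM: "a \<in> M n \<Lambda> R"
  obtains x where "orthonormal (SIGMA k:{..<n}. {..<R ! k}) x"
    and "a = (\<Sum>k<n. \<Lambda> ! k *\<^sub>C (\<Sum>i<R ! k. dyad (x (k, i))))"
proof -
  obtain e where e: "\<And>k. k < n \<Longrightarrow> projection (e k)" "\<And>k. k < n \<Longrightarrow> op_rank (e k) = R ! k"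
    and orth: "\<And>j k. j < n \<Longrightarrow> k < n \<Longrightarrow> j \<noteq> k \<Longrightarrow> e j * e k = 0"
    and a: "a = (\<Sum>k<n. \<Lambda> ! k *\<^sub>C e k)"
    using ME[OF aM] by blast
  have "\<exists>x. orthonormal {..<R ! k} x \<and> e k = (\<Sum>i<R ! k. dyad (x i))" if "k < n" for k
  proof -
    have "finite_rank (e k)"
      using par e(2)[OF that] that by (intro finite_rank_if_op_rank_pos) (simp add: parameters_def)
    then show ?thesis
      using projection_eq_sum_dyad[OF e(1)[OF that]] e(2)[OF that] by metis
  qed
  then obtain x where x: "\<And>k. k < n \<Longrightarrow> orthonormal {..<R ! k} (x k)"
    and ex: "\<And>k. k < n \<Longrightarrow> e k = (\<Sum>i<R ! k. dyad (x k i))"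
    by metis
  have fixed: "bop_apply (e k) (x k i) = x k i" if "k < n" "i < R ! k" for k i
    using sum_dyad_apply[OF x[OF that(1)]] that by (simp add: ex)
  \<comment> \<open>Vectors from different ranges are orthogonal because
    \<open>e k * e j = 0\<close> and \<open>e k\<close> is self-adjoint.\<close>
  have "cinner (x j i) (x k l) = 0" if "j < n" "i < R ! j" "k < n" "l < R ! k" "j \<noteq> k" for j i k l
  proof -
    have "cinner (x j i) (x k l) = cinner (bop_apply (e j) (x j i)) (bop_apply (adj (e k)) (x k l))"
      using fixed e(1) that by (simp add: projection_def)
    also have "\<dots> = cinner (bop_apply (e k * e j) (x j i)) (x k l)"
      by (simp add: cinner_adj_right bop_apply_mult)
    also have "\<dots> = 0"
      using orth that by (simp add: bop_apply_zero)
    finally show ?thesis .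
  qed
  then have "cinner (x j i) (x k l) = (if (j, i) = (k, l) then 1 else 0)"
    if "j < n" "i < R ! j" "k < n" "l < R ! k" for j i k l
    using x[OF that(1)] that by (cases "j = k") (simp_all add: orthonormal_def)
  then have "orthonormal (SIGMA k:{..<n}. {..<R ! k}) (\<lambda>(k, i). x k i)"
    by (simp add: orthonormal_def)
  then show ?thesis
    using that ex a by simp
qed

theorem Aut0_transitive_M:
  assumes par: "parameters n \<Lambda> R" and a: "a \<in> M n \<Lambda> R" and b: "b \<in> M n \<Lambda> R"
  shows "\<exists>\<Phi>\<in>Aut0. blinfun_apply \<Phi> a = b"
proof -
  let ?I = "SIGMA k:{..<n}. {..<R ! k}"
  obtain x where x: "orthonormal ?I x" "a = (\<Sum>k<n. \<Lambda> ! k *\<^sub>C (\<Sum>i<R ! k. dyad (x (k, i))))"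
    using M_orthonormal[OF par a] .
  obtain y where y: "orthonormal ?I y" "b = (\<Sum>k<n. \<Lambda> ! k *\<^sub>C (\<Sum>i<R ! k. dyad (y (k, i))))"
    using M_orthonormal[OF par b] .
  have "finite ?I" by simp
  then obtain u where u: "Ad u \<in> Aut0" "\<forall>i\<in>?I. bop_apply u (x i) = y i"
    using ex_unitary_transporting_orthonormal[OF _ x(1) y(1)] by blast
  \<comment> \<open>By \<open>conj_dyad\<close>, conjugation with \<open>u\<close> replaces each
    dyad of \<open>x (k, i)\<close> by that of \<open>y (k, i)\<close>.\<close>
  have "blinfun_apply (Ad u) a = b"
    unfolding x(2) y(2) Ad_apply sum_distrib_left sum_distrib_right mult_scaleC conj_dyad
    using u(2) by simp
  with u(1) show ?thesis by blast
qed

theorem connected_M: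
  assumes par: "parameters n \<Lambda> R"
  shows "connected (M n \<Lambda> R :: 'a::complex_hilbert bop set)"
\<comment> \<open>The set is empty when the dimension of the space is smaller than the sum of the
  prescribed ranks; otherwise it is a single orbit.\<close>
proof (cases "(M n \<Lambda> R :: 'a bop set) = {}")
  case False
  then obtain a :: "'a bop" where a: "a \<in> M n \<Lambda> R" by blast
  have "M n \<Lambda> R = (\<lambda>\<Phi>. blinfun_apply \<Phi> a) ` Aut0"
  proof
    show "M n \<Lambda> R \<subseteq> (\<lambda>\<Phi>. blinfun_apply \<Phi> a) ` Aut0"
      using Aut0_transitive_M[OF par a] by blast
    show "(\<lambda>\<Phi>. blinfun_apply \<Phi> a) ` Aut0 \<subseteq> M n \<Lambda> R"
      using star_automorphism_M[OF par Aut0_star_automorphism a] by blast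
  qed
  moreover have "continuous_on Aut0 (\<lambda>\<Phi>. blinfun_apply \<Phi> a)"
    by (intro continuous_intros)
  ultimately show ?thesis
    using connected_continuous_image connected_Aut0 by metis
qed simp

theorem proposition3p1:
  "(normal_algebraic_finite_rank :: 'a::complex_hilbert bop set) =
      \<Union> {M n \<Lambda> R | n \<Lambda> R. parameters n \<Lambda> R} \<and>
   (\<forall>n \<Lambda> R n' \<Lambda>' R'. parameters n \<Lambda> R \<longrightarrow> parameters n' \<Lambda>' R' \<longrightarrow>
      (if same_up_to_permutation (n, \<Lambda>, R) (n', \<Lambda>', R')
       then (M n \<Lambda> R :: 'a bop set) = M n' \<Lambda>' R'
       else (M n \<Lambda> R :: 'a bop set) \<inter> M n' \<Lambda>' R' = {})) \<and>
   (\<forall>n \<Lambda> R. parameters n \<Lambda> R \<longrightarrow>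
      (\<forall>\<Phi>\<in>Aut0. blinfun_apply \<Phi> ` (M n \<Lambda> R :: 'a bop set) \<subseteq> M n \<Lambda> R) \<and>
      connected (M n \<Lambda> R :: 'a bop set) \<and>
      (\<forall>a\<in>(M n \<Lambda> R :: 'a bop set). \<forall>b\<in>M n \<Lambda> R. \<exists>\<Phi>\<in>Aut0. blinfun_apply \<Phi> a = b))"
proof (intro conjI allI impI ballI)
  show "(normal_algebraic_finite_rank :: 'a bop set) = \<Union> {M n \<Lambda> R | n \<Lambda> R. parameters n \<Lambda> R}"
  proof (intro equalityI subsetI)
    fix a :: "'a bop" assume "a \<in> normal_algebraic_finite_rank"
    then show "a \<in> \<Union> {M n \<Lambda> R | n \<Lambda> R. parameters n \<Lambda> R}"
      using normal_algebraic_finite_rank_in_M by blast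
  next
    fix a :: "'a bop" assume "a \<in> \<Union> {M n \<Lambda> R | n \<Lambda> R. parameters n \<Lambda> R}"
    then obtain n \<Lambda> R where "parameters n \<Lambda> R" "a \<in> M n \<Lambda> R"
      by blast
    then show "a \<in> normal_algebraic_finite_rank"
      by (rule M_subset_normal_algebraic_finite_rank)
  qed
next
  fix n \<Lambda> R n' \<Lambda>' R'
  assume par: "parameters n \<Lambda> R" "parameters n' \<Lambda>' R'"
  show "if same_up_to_permutation (n, \<Lambda>, R) (n', \<Lambda>', R')
      then (M n \<Lambda> R :: 'a bop set) = M n' \<Lambda>' R' else (M n \<Lambda> R :: 'a bop set) \<inter> M n' \<Lambda>' R' = {}"
    using M_eq_if_same_up_to_permutation[OF par(1)] same_up_to_permutation_if_common_element[OF par]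
    by (simp add: disjoint_iff) blast
next
  fix n \<Lambda> R and \<Phi> :: "'a bop \<Rightarrow>\<^sub>L 'a bop"
  assume "parameters n \<Lambda> R" "\<Phi> \<in> Aut0"
  then show "blinfun_apply \<Phi> ` (M n \<Lambda> R :: 'a bop set) \<subseteq> M n \<Lambda> R"
    by (auto intro: star_automorphism_M Aut0_star_automorphism)
next
  fix n \<Lambda> R
  assume par: "parameters n \<Lambda> R"
  show "connected (M n \<Lambda> R :: 'a bop set)"
    by (rule connected_M[OF par])
  show "\<exists>\<Phi>\<in>Aut0. blinfun_apply \<Phi> a = b" if "a \<in> M n \<Lambda> R" "b \<in> M n \<Lambda> R" for a b :: "'a bop"
    by (rule Aut0_transitive_M[OF par that])
qed

end
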